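(* Let $m,n$ be nonnegative integers with $n\ge m+1$ and let $\varphi\in\mathcal{LP}_m$. If $P,Q\in\mathcal{H}_n$ are such that $Q\preccurlyeq P$, then $\mathcal{D}(\varphi,n)[Q]\preccurlyeq\mathcal{D}(\varphi,n)[P]$ in $\mathcal{H}_{n-m}$.
   Context: $\mathcal{H}_n$ denotes the set of monic univariate polynomials of degree $n$ all of whose zeros are real; $\mathcal{Z}(P)$ is the unordered tuple of zeros of $P$ counted with multiplicity. Spectral order: for unordered real $n$-tuples $X,Y$ write $X\prec Y$ if $\sum_{i=1}^n f(x_i)\le\sum_{i=1}^n f(y_i)$ for every convex $f:\mathbb{R}\to\mathbb{R}$ (equivalently, $X=AY$ as column vectors for some doubly stochastic matrix $A$); for $P,Q\in\mathcal{H}_n$ write $Q\preccurlyeq P$ if $\mathcal{Z}(Q)\prec\mathcal{Z}(P)$. The Laguerre-Pólya class $\mathcal{LP}$ is the set of real entire functions of the form $\varphi(x)=cx^me^{-a^2x^2+bx}\prod_{k=1}^\infty(1-\alpha_kx)e^{\alpha_kx}$ with $a,b,c,\alpha_k\in\mathbb{R}$, $c\ne0$, $m$ a nonnegative integer and $\sum_k\alpha_k^2<\infty$ (some or all $\alpha_k$ may be $0$). $\mathcal{LP}_m$ is the set of $\varphi\in\mathcal{LP}$ having a zero of order exactly $m$ at $0$. With $D=d/dx$ and $\varphi(x)=\sum_k a_kx^k$, put $\varphi(D)[P]=\sum_k a_kP^{(k)}$ for polynomials $P$ (a finite sum). For $\varphi\in\mathcal{LP}_m$ and $n\ge m+1$,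 $\mathcal{D}(\varphi,n)=\left[\binom{n}{m}\varphi^{(m)}(0)\right]^{-1}\varphi(D)$, which maps monic polynomials of degree $n$ to monic polynomials of degree $n-m$. (By a classical theorem of Pólya, $\varphi(D)$ maps polynomials with only real zeros to polynomials with only real zeros, so $\mathcal{D}(\varphi,n)$ maps $\mathcal{H}_n$ into $\mathcal{H}_{n-m}$.) *)

theory Defs
  imports "HOL-Complex_Analysis.Complex_Analysis"
begin

text \<open>Polynomials have complex coefficients, so that ``all zeros are real'' refers to all complex
  zeros; for a monic polynomial it forces the coefficients to be real.\<close>

definition hyperbolic :: "nat \<Rightarrow> complex poly set" where
  "hyperbolic n = {P. lead_coeff P = 1 \<and> degree P = n \<and> (\<forall>z. poly P z = 0 \<longrightarrow> z \<in> \<real>)}"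

text \<open>Only meant for polynomials all of whose zeros are real; there \<^const>\<open>Re\<close> merely
  converts the zeros to type \<^typ>\<open>real\<close>.\<close>

definition zeros :: "complex poly \<Rightarrow> real multiset" where
  "zeros P = image_mset Re (proots P)"

definition spectral_prec :: "real multiset \<Rightarrow> real multiset \<Rightarrow> bool" where
  "spectral_prec X Y \<longleftrightarrow> size X = size Y \<and>
     (\<forall>f :: real \<Rightarrow> real. convex_on UNIV f \<longrightarrow> (\<Sum>x\<in>#X. f x) \<le> (\<Sum>y\<in>#Y. f y))"

definition spectral_le :: "complex poly \<Rightarrow> complex poly \<Rightarrow> bool" where
  "spectral_le Q P \<longleftrightarrow> spectral_prec (zeros Q) (zeros P)"

text \<open>Square summability makes the infinite product converge (in the sense of
  \<^const>\<open>convergent_prod\<close>) for every \<open>z\<close>, so \<^const>\<open>prodinf\<close> is its genuine value.\<close>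

definition laguerre_polya :: "(complex \<Rightarrow> complex) set" where
  "laguerre_polya = {\<phi>. \<exists>(a::real) (b::real) (c::real) (\<alpha>::nat \<Rightarrow> real) (m::nat).
     c \<noteq> 0 \<and> summable (\<lambda>k. (\<alpha> k)\<^sup>2) \<and>
     (\<forall>z. \<phi> z = of_real c * z ^ m * exp (- (of_real a)\<^sup>2 * z\<^sup>2 + of_real b * z) *
            (\<Prod>k. (1 - of_real (\<alpha> k) * z) * exp (of_real (\<alpha> k) * z)))}"

definition laguerre_polya_order :: "nat \<Rightarrow> (complex \<Rightarrow> complex) set" where
  "laguerre_polya_order m = {\<phi> \<in> laguerre_polya. zorder \<phi> 0 = int m}"

text \<open>The Taylor coefficients of \<open>\<phi>\<close> at \<open>0\<close> are \<open>(deriv ^^ k) \<phi> 0 / fact k\<close>, and derivatives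
  of \<open>P\<close> beyond its degree vanish.\<close>

definition diff_op :: "(complex \<Rightarrow> complex) \<Rightarrow> complex poly \<Rightarrow> complex poly" where
  "diff_op \<phi> P = (\<Sum>k\<le>degree P. smult ((deriv ^^ k) \<phi> 0 / fact k) ((pderiv ^^ k) P))"

definition normalized_diff_op ::
    "nat \<Rightarrow> (complex \<Rightarrow> complex) \<Rightarrow> nat \<Rightarrow> complex poly \<Rightarrow> complex poly" where
  "normalized_diff_op m \<phi> n P = smult (inverse (of_nat (n choose m) * (deriv ^^ m) \<phi> 0)) (diff_op \<phi> P)"

end

theory Submission
  imports Defs "HOL-Computational_Algebra.Fundamental_Theorem_Algebra"
begin

text \<open>The operators \<open>\<phi>(D)\<close>, restricted to polynomials of degree \<open>n\<close>, are up to normalization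
  coefficientwise limits of compositions of \<open>D\<close> and of operators \<open>1 + b D\<close> with \<open>b\<close> real, and monotonicity for
  the spectral order survives compositions and (by compactness of the tuples of zeros) limits.
  So only \<open>T = a + b D\<close> matters. By the theorem of Hardy, Littlewood and Polya it suffices to
  replace two zeros \<open>m - d, m + d\<close> of \<open>p = ((x - m)\<^sup>2 - d\<^sup>2) R\<close> by \<open>m - d', m + d'\<close> with \<open>d' < d\<close>; this adds
  a positive multiple of \<open>t = T R\<close> to \<open>g = T p\<close>. At a zero \<open>y\<close> of \<open>g\<close> one computes
  \<open>p\<^sup>2 g' t = 2 b\<^sup>2 (y - m) R\<^sup>2 (p'\<^sup>2 - p p'')\<close>, and \<open>p'\<^sup>2 - p p'' > 0\<close> for simple real zeros. Hence every
  zero of \<open>g\<close> moves towards \<open>m\<close> without crossing it, while the sum of the zeros is unchanged;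
  this decreases the sum of any convex function over the zeros.\<close>

subsection \<open>Real polynomials with real zeros\<close>

definition root_poly :: "(nat \<Rightarrow> real) \<Rightarrow> nat set \<Rightarrow> real poly" where
  "root_poly x I = (\<Prod>i\<in>I. [:- x i, 1:])"

lemma root_poly_insert:
  "finite I \<Longrightarrow> i \<notin> I \<Longrightarrow> root_poly x (insert i I) = [:- x i, 1:] * root_poly x I"
  by (simp add: root_poly_def)

lemma root_poly_remove:
  "finite I \<Longrightarrow> i \<in> I \<Longrightarrow> root_poly x I = [:- x i, 1:] * root_poly x (I - {i})"
  unfolding root_poly_def by (rule prod.remove)

lemma root_poly_cong: "(\<And>i. i \<in> I \<Longrightarrow> x i = y i) \<Longrightarrow> root_poly x I = root_poly y I"
  by (simp add: root_poly_def)

lemma poly_root_poly: "poly (root_poly x I) z = (\<Prod>i\<in>I. z - x i)"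
  by (simp add: root_poly_def poly_prod)

lemma poly_root_poly_eq_0_iff: "finite I \<Longrightarrow> poly (root_poly x I) z = 0 \<longleftrightarrow> z \<in> x ` I"
  by (auto simp: poly_root_poly)

lemma degree_root_poly: "finite I \<Longrightarrow> degree (root_poly x I) = card I"
  unfolding root_poly_def by (subst degree_prod_eq_sum_degree) auto

lemma lead_coeff_root_poly: "lead_coeff (root_poly x I) = 1"
  unfolding root_poly_def by (simp add: lead_coeff_prod)

lemma coeff_root_poly_pred:
  "coeff (root_poly x {..<Suc n}) n = - (\<Sum>i<Suc n. x i)"
proof (induction n)
  case 0
  then show ?case by (simp add: root_poly_def)
next
  case (Suc n)
  have eq: "root_poly x {..<Suc (Suc n)} = [:- x (Suc n), 1:] * root_poly x {..<Suc n}"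
    by (subst lessThan_Suc, rule root_poly_insert) auto
  have 1: "coeff (root_poly x {..<Suc n}) (Suc n) = 1"
    using lead_coeff_root_poly[of x "{..<Suc n}"] by (simp add: degree_root_poly)
  show ?case unfolding eq using Suc 1 by simp
qed

section \<open>Laguerre's inequality for products of linear factors\<close>

definition laguerre_expr :: "real poly \<Rightarrow> real \<Rightarrow> real" where
  "laguerre_expr p z = (poly (pderiv p) z)\<^sup>2 - poly p z * poly (pderiv (pderiv p)) z"

text \<open>Where p does not vanish, \<open>laguerre_expr p\<close> is -p^2 (p'/p)'. A factor x - a
  adds 1/(x - a)^2 to -(p'/p)'; clearing denominators gives this recursion, on which the induction
  over the zeros rests.\<close>

lemma laguerre_expr_linear_mult:
  "laguerre_expr ([:- a, 1:] * u) z = (poly u z)\<^sup>2 + (z - a)\<^sup>2 * laguerre_expr u z"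
  unfolding laguerre_expr_def pderiv_mult pderiv_add pderiv_pCons
  by (simp add: algebra_simps power2_eq_square)

lemma laguerre_expr_nonneg: "finite I \<Longrightarrow> laguerre_expr (root_poly x I) z \<ge> 0"
proof (induction I rule: finite_induct)
  case empty
  then show ?case by (simp add: root_poly_def laguerre_expr_def)
next
  case (insert i I)
  then show ?case by (simp add: root_poly_insert laguerre_expr_linear_mult del: mult_pCons_left)
qed

text \<open>When the zeros are simple, one of them can be split off so that the remaining factor
  does not vanish at \<open>z\<close>: the zero at \<open>z\<close> itself if there is one,
  otherwise any. The square in \<open>laguerre_expr_linear_mult\<close> is then positive.\<close>

lemma laguerre_expr_pos:
  assumes "finite I" "I \<noteq> {}" "inj_on x I"
  shows "laguerre_expr (root_poly x I) z > 0"
proof -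
  obtain i where i: "i \<in> I" "z \<notin> x ` (I - {i})"
  proof (cases "z \<in> x ` I")
    case True
    then obtain i where "i \<in> I" "z = x i" by auto
    then show ?thesis using that[of i] assms(3) by (auto simp: inj_on_def)
  next
    case False
    then show ?thesis using that assms(2) by auto
  qed
  have "poly (root_poly x (I - {i})) z \<noteq> 0"
    using i assms(1) by (simp add: poly_root_poly_eq_0_iff)
  then show ?thesis
    unfolding root_poly_remove[OF assms(1) i(1)] laguerre_expr_linear_mult
    by (intro add_pos_nonneg mult_nonneg_nonneg laguerre_expr_nonneg) (use assms in auto)
qed

text \<open>Write g = (x - b) u. Then u(b) = g'(b), and u has no zero on the segment, so by the
  intermediate value theorem u(a) and u(b) have the same sign.\<close>

lemma poly_sign_next_to_simple_root:
  fixes g :: "real poly"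
  assumes "poly g b = 0" "poly (pderiv g) b \<noteq> 0" "a \<noteq> b"
    and nz: "\<And>z. z \<in> closed_segment a b \<Longrightarrow> z \<noteq> b \<Longrightarrow> poly g z \<noteq> 0"
  shows "(a - b) * poly g a * poly (pderiv g) b > 0"
proof -
  obtain u where u: "g = [:- b, 1:] * u"
    using assms(1) by (auto simp: poly_eq_0_iff_dvd dvd_def)
  have ub: "poly (pderiv g) b = poly u b"
    unfolding u pderiv_mult by (simp add: pderiv_pCons)
  have unz: "poly u z \<noteq> 0" if "z \<in> closed_segment a b" for z
    using nz[OF that] assms(2) ub unfolding u by (cases "z = b") auto
  have "poly u a * poly u b > 0"
  proof (rule ccontr)
    assume "\<not> ?thesis"
    moreover have "poly u a \<noteq> 0" "poly u b \<noteq> 0" using unz by auto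
    ultimately have neg: "poly u a * poly u b < 0"
      by (metis linorder_neqE_linordered_idom mult_eq_0_iff)
    show False
    proof (cases "a < b")
      case True
      from poly_IVT[OF this neg] obtain z where "a < z" "z < b" "poly u z = 0" by blast
      then show False using unz[of z] by (auto simp: closed_segment_eq_real_ivl)
    next
      case False
      then have "b < a" using assms(3) by auto
      from poly_IVT[OF this] neg obtain z where "b < z" "z < a" "poly u z = 0"
        by (auto simp: mult.commute)
      then show False using unz[of z] False by (auto simp: closed_segment_eq_real_ivl)
    qed
  qed
  moreover have "(a - b) * poly g a * poly (pderiv g) b = (a - b)\<^sup>2 * (poly u a * poly u b)"
    unfolding ub by (simp add: u algebra_simps power2_eq_square)
  ultimately show ?thesis using assms(3) by (simp add: zero_less_mult_iff)
qed

text \<open>The difference of both sides has no terms of order \<open>N\<close> or higher and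
  vanishes at \<open>N\<close> distinct points.\<close>

lemma poly_eq_smult_root_poly:
  fixes p :: "real poly"
  assumes "degree p \<le> N" "coeff p N = l"
    and "\<And>j k. j < k \<Longrightarrow> k < N \<Longrightarrow> y j < y k"
    and "\<And>j. j < N \<Longrightarrow> poly p (y j) = 0"
  shows "p = smult l (root_poly y {..<N})"
proof (rule poly_eqI_degree_lead_coeff)
  have "inj_on y {..<N}"
    by (rule linorder_inj_onI) (use assms(3) in fastforce)+
  then show "card (y ` {..<N}) \<ge> N" by (simp add: card_image)
  show "coeff p N = coeff (smult l (root_poly y {..<N})) N"
    using assms(2) lead_coeff_root_poly[of y "{..<N}"] by (simp add: degree_root_poly)
  show "degree (smult l (root_poly y {..<N})) \<le> N"
    using degree_smult_le[of l "root_poly y {..<N}"] by (simp add: degree_root_poly)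
  show "poly p z = poly (smult l (root_poly y {..<N})) z" if "z \<in> y ` {..<N}" for z
    using that assms(4) by (auto simp: poly_root_poly_eq_0_iff poly_root_poly)
qed (use assms in auto)

text \<open>At each root \<open>y j\<close> the hypothesis \<open>root\<close> says that \<open>g + t\<close> has at \<open>y j\<close> the sign that \<open>g\<close>
  takes just beyond \<open>y j\<close>, seen from \<open>m\<close>. Hence \<open>g + t\<close> changes sign between consecutive roots of \<open>g\<close>
  on the same side of \<open>m\<close>, and between \<open>m\<close> and the nearest root on either side.\<close>

lemma roots_move_towards:
  fixes g t :: "real poly"
  assumes g: "g = smult l (root_poly y {..<N})" and l: "l \<noteq> 0"
    and strict: "\<And>j k. j < k \<Longrightarrow> k < N \<Longrightarrow> y j < y k"
    and root: "\<And>j. j < N \<Longrightarrow> (y j - m) * poly t (y j) * poly (pderiv g) (y j) > 0"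
    and mid: "poly g m * poly (g + t) m > 0"
    and small: "\<And>k. N \<le> Suc k \<Longrightarrow> coeff t k = 0"
  obtains y' where "g + t = smult l (root_poly y' {..<N})"
    and "(\<Sum>j<N. y' j) = (\<Sum>j<N. y j)"
    and "\<And>j. j < N \<Longrightarrow> y' j \<in> closed_segment m (y j)"
proof -
  let ?G = "g + t"
  have mono: "y j \<le> y k" if "j \<le> k" "k < N" for j k
    using strict[of j k] that by (cases "j = k") auto
  have g0: "poly g z = 0 \<longleftrightarrow> (\<exists>j<N. z = y j)" for z
    using l by (auto simp: g poly_root_poly_eq_0_iff)
  have Gy: "poly ?G (y j) = poly t (y j)" if "j < N" for j
    using that g0 by auto
  have d0: "poly (pderiv g) (y j) \<noteq> 0" "y j \<noteq> m" if "j < N" for j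
    using root[OF that] by auto
  have far: "(a - y j) * poly g a * poly (pderiv g) (y j) > 0"
    if "j < N" "a \<noteq> y j" "\<And>k. k < N \<Longrightarrow> k \<noteq> j \<Longrightarrow> y k \<notin> closed_segment a (y j)" for a j
  proof (rule poly_sign_next_to_simple_root)
    show "poly g z \<noteq> 0" if "z \<in> closed_segment a (y j)" "z \<noteq> y j" for z
      using that \<open>\<And>k. k < N \<Longrightarrow> k \<noteq> j \<Longrightarrow> y k \<notin> _\<close> unfolding g0 by blast
  qed (use that g0 d0 in auto)
  \<comment> \<open>The midpoint of two neighbouring zeros lies to the right of one and to the left
    of the other, so comparing both derivatives with the sign of \<open>g\<close> there gives
    opposite signs.\<close>
  have alt: "poly (pderiv g) (y j) * poly (pderiv g) (y (Suc j)) < 0" if "Suc j < N" for j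
  proof -
    define c where "c = (y j + y (Suc j)) / 2"
    have c: "y j < c" "c < y (Suc j)" using strict[of j "Suc j"] that by (auto simp: c_def)
    have "(c - y j) * poly g c * poly (pderiv g) (y j) > 0"
    proof (rule far)
      fix k assume "k < N" "k \<noteq> j"
      then show "y k \<notin> closed_segment c (y j)"
        using c mono[of k j] strict[of k j] mono[of "Suc j" k] that
        by (cases "k < j") (auto simp: closed_segment_eq_real_ivl)
    qed (use that c in auto)
    moreover have "(c - y (Suc j)) * poly g c * poly (pderiv g) (y (Suc j)) > 0"
    proof (rule far)
      fix k assume "k < N" "k \<noteq> Suc j"
      then show "y k \<notin> closed_segment c (y (Suc j))"
        using c mono[of k j] strict[of "Suc j" k] that
        by (cases "k \<le> j") (auto simp: closed_segment_eq_real_ivl)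
    qed (use that c in auto)
    ultimately show ?thesis using c
      by (auto simp: zero_less_mult_iff mult_less_0_iff)
  qed
  \<comment> \<open>The new zero lies between \<open>y j\<close> and its neighbour in the direction
    of \<open>m\<close>, where \<open>m\<close> itself replaces the neighbour for the zero closest
    to \<open>m\<close> on either side. These intervals are disjoint and ordered like the
    \<open>y j\<close>, so the \<open>N\<close> zeros found are distinct and exhaust those of
    \<open>g + t\<close>.\<close>
  have ex: "\<exists>z. poly ?G z = 0 \<and>
      (m < y j \<longrightarrow> m < z \<and> z < y j \<and> (\<forall>k<j. y k < z)) \<and>
      (y j < m \<longrightarrow> y j < z \<and> z < m \<and> (\<forall>k. j < k \<and> k < N \<longrightarrow> z < y k))" (is "\<exists>z. ?P z")
    if j: "j < N" for j
  proof (cases "m < y j")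
    case True
    show ?thesis
    proof (cases "j > 0 \<and> m < y (j - 1)")
      case True
      then obtain i where i: "j = Suc i" "m < y i" by (cases j) auto
      have "poly t (y i) * poly t (y j) < 0"
        using alt[of i] root[of i] root[of j] j i \<open>m < y j\<close>
        by (auto simp: zero_less_mult_iff mult_less_0_iff)
      then have "poly ?G (y i) * poly ?G (y j) < 0" using Gy i j by simp
      moreover have "y i < y j" using strict i j by simp
      ultimately obtain z where z: "y i < z" "z < y j" "poly ?G z = 0"
        using poly_IVT by blast
      have "y k < z" if "k < j" for k using mono[of k i] that i j z by auto
      moreover have "m < z" using z(1) i(2) by simp
      ultimately show ?thesis using z \<open>m < y j\<close> by (intro exI[of _ z]) auto
    next
      case False
      have low: "y k < m" if "k < j" for k
      proof -
        have "y k \<le> y (j - 1)" using mono[of k "j - 1"] that j by auto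
        moreover have "y (j - 1) < m" using False that j d0(2)[of "j - 1"] by force
        ultimately show ?thesis by simp
      qed
      have "(m - y j) * poly g m * poly (pderiv g) (y j) > 0"
      proof (rule far)
        fix k assume "k < N" "k \<noteq> j"
        then show "y k \<notin> closed_segment m (y j)"
          using low[of k] strict[of j k] \<open>m < y j\<close>
          by (cases "k < j") (auto simp: closed_segment_eq_real_ivl)
      qed (use \<open>m < y j\<close> j in auto)
      then have "poly ?G m * poly ?G (y j) < 0"
        using root[OF j] mid \<open>m < y j\<close> Gy[OF j]
        by (auto simp: zero_less_mult_iff mult_less_0_iff)
      then obtain z where z: "m < z" "z < y j" "poly ?G z = 0"
        using poly_IVT[OF \<open>m < y j\<close>] by blast
      then show ?thesis using low \<open>m < y j\<close> by (intro exI[of _ z]) force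
    qed
  next
    case False
    then have lt: "y j < m" using d0(2)[OF j] by simp
    show ?thesis
    proof (cases "Suc j < N \<and> y (Suc j) < m")
      case True
      have "poly t (y j) * poly t (y (Suc j)) < 0"
        using alt[of j] root[of j] root[of "Suc j"] True lt j
        by (auto simp: zero_less_mult_iff mult_less_0_iff)
      then have "poly ?G (y j) * poly ?G (y (Suc j)) < 0" using Gy True j by simp
      moreover have "y j < y (Suc j)" using strict True by simp
      ultimately obtain z where z: "y j < z" "z < y (Suc j)" "poly ?G z = 0"
        using poly_IVT by blast
      have "z < y k" if "j < k" "k < N" for k using mono[of "Suc j" k] that z by auto
      moreover have "z < m" using z(2) True by simp
      ultimately show ?thesis using z lt by (intro exI[of _ z]) auto
    next
      case False
      have high: "m < y k" if "j < k" "k < N" for k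
      proof -
        have "y (Suc j) \<le> y k" using mono[of "Suc j" k] that by auto
        moreover have "m < y (Suc j)" using False that d0(2)[of "Suc j"] by force
        ultimately show ?thesis by simp
      qed
      have "(m - y j) * poly g m * poly (pderiv g) (y j) > 0"
      proof (rule far)
        fix k assume "k < N" "k \<noteq> j"
        then show "y k \<notin> closed_segment m (y j)"
          using high[of k] strict[of k j] lt j
          by (cases "k < j") (auto simp: closed_segment_eq_real_ivl)
      qed (use lt j in auto)
      then have "poly ?G (y j) * poly ?G m < 0"
        using root[OF j] mid lt Gy[OF j]
        by (auto simp: zero_less_mult_iff mult_less_0_iff)
      then obtain z where z: "y j < z" "z < m" "poly ?G z = 0"
        using poly_IVT[OF lt] by blast
      then show ?thesis using high lt by (intro exI[of _ z]) force
    qed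
  qed
  then obtain y' where y': "\<And>j. j < N \<Longrightarrow> poly ?G (y' j) = 0 \<and>
      (m < y j \<longrightarrow> m < y' j \<and> y' j < y j \<and> (\<forall>k<j. y k < y' j)) \<and>
      (y j < m \<longrightarrow> y j < y' j \<and> y' j < m \<and> (\<forall>k. j < k \<and> k < N \<longrightarrow> y' j < y k))"
    by metis
  have strict': "y' j < y' k" if "j < k" "k < N" for j k
    using y'[of j] y'[of k] d0(2)[of j] d0(2)[of k] that strict[OF that]
    by (smt (verit) order.strict_trans)
  have cg: "coeff g N = l" "degree g \<le> N"
    using lead_coeff_root_poly[of y "{..<N}"] l by (auto simp: g degree_root_poly)
  have "degree t \<le> N" using small by (intro degree_le) auto
  then have deg: "degree ?G \<le> N" using cg by (intro degree_add_le) auto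
  have G: "?G = smult l (root_poly y' {..<N})"
  proof (rule poly_eq_smult_root_poly[OF deg])
    show "coeff ?G N = l" using cg small[of N] by simp
  qed (use y' strict' in auto)
  \<comment> \<open>The coefficient of index N - 1 is \<open>l\<close> times minus the sum of the
    zeros, and by \<open>small\<close> the polynomial \<open>t\<close> does not contribute to
    it.\<close>
  have "(\<Sum>j<N. y' j) = (\<Sum>j<N. y j)"
  proof (cases N)
    case (Suc M)
    have "coeff ?G M = coeff g M" using small[of M] Suc by simp
    then show ?thesis using l unfolding G Suc unfolding g Suc by (simp add: coeff_root_poly_pred)
  qed simp
  moreover have "y' j \<in> closed_segment m (y j)" if "j < N" for j
    using y'[OF that] d0(2)[OF that] by (auto simp: closed_segment_eq_real_ivl)
  ultimately show thesis using that[of y'] G by blast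
qed

section \<open>Convex functions under displacement towards a point\<close>

lemma convex_ge_affine:
  fixes f :: "real \<Rightarrow> real"
  assumes "convex_on UNIV f"
  obtains \<mu> where "\<And>y. f y \<ge> f m + \<mu> * (y - m)"
  using convex_le_Inf_differential[OF assms, of m] by auto

text \<open>For y' = (1 - u) m + u y, convexity combined with 1 - u times the supporting line of
  slope \<mu> at \<open>m\<close> gives f(y') + \<mu> (y - y') \<le> f(y). The point
  \<open>m\<close> and hence \<mu> are common to all indices, so the linear terms cancel in the
  sum.\<close>

lemma convex_sum_le_towards:
  fixes f :: "real \<Rightarrow> real"
  assumes f: "convex_on UNIV f" and sum: "(\<Sum>j\<in>A. y' j) = (\<Sum>j\<in>A. y j)"
    and seg: "\<And>j. j \<in> A \<Longrightarrow> y' j \<in> closed_segment m (y j)"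
  shows "(\<Sum>j\<in>A. f (y' j)) \<le> (\<Sum>j\<in>A. f (y j))"
proof -
  obtain \<mu> where \<mu>: "\<And>y. f y \<ge> f m + \<mu> * (y - m)"
    using convex_ge_affine[OF f] by blast
  have "f (y' j) + \<mu> * (y j - y' j) \<le> f (y j)" if j: "j \<in> A" for j
  proof -
    obtain u where u: "0 \<le> u" "u \<le> 1" "y' j = (1 - u) * m + u * y j"
      using seg[OF j] by (auto simp: closed_segment_def)
    have "f (y' j) \<le> (1 - u) * f m + u * f (y j)"
      using convex_onD[OF f, of u m "y j"] u by simp
    moreover have "(1 - u) * (f m + \<mu> * (y j - m)) \<le> (1 - u) * f (y j)"
      using \<mu> u by (intro mult_left_mono) auto
    ultimately show ?thesis by (simp add: u(3) algebra_simps)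
  qed
  then have "(\<Sum>j\<in>A. f (y' j) + \<mu> * (y j - y' j)) \<le> (\<Sum>j\<in>A. f (y j))"
    by (intro sum_mono)
  then show ?thesis
    using sum by (simp add: sum.distrib sum_subtractf flip: sum_distrib_left)
qed

subsection \<open>Pinching two zeros\<close>

abbreviation cpoly :: "real poly \<Rightarrow> complex poly" where
  "cpoly \<equiv> map_poly complex_of_real"

lemma coeff_cpoly: "coeff (cpoly p) k = of_real (coeff p k)"
  by (simp add: coeff_map_poly)

lemma cpoly_add: "cpoly (p + q) = cpoly p + cpoly q"
  by (rule poly_eqI) (simp add: coeff_cpoly)

lemma cpoly_smult: "cpoly (smult c p) = smult (of_real c) (cpoly p)"
  by (rule poly_eqI) (simp add: coeff_cpoly)

lemma cpoly_mult: "cpoly (p * q) = cpoly p * cpoly q"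
  by (rule poly_eqI) (simp add: coeff_cpoly coeff_mult)

lemma cpoly_pderiv: "cpoly (pderiv p) = pderiv (cpoly p)"
  by (rule poly_eqI) (simp add: coeff_cpoly coeff_pderiv)

lemma cpoly_inject: "cpoly p = cpoly q \<longleftrightarrow> p = q"
  by (metis coeff_cpoly of_real_eq_iff poly_eqI)

lemma cpoly_root_poly: "finite I \<Longrightarrow> cpoly (root_poly x I) = (\<Prod>i\<in>I. [:- complex_of_real (x i), 1:])"
proof (induction I rule: finite_induct)
  case (insert i I)
  have "cpoly [:- x i, 1:] = [:- complex_of_real (x i), 1:]"
    by (simp add: map_poly_pCons)
  then show ?case
    unfolding root_poly_insert[OF insert(1,2)] cpoly_mult prod.insert[OF insert(1,2)] insert.IH
    by (simp only:)
qed (simp add: root_poly_def)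

lemma degree_cpoly: "degree (cpoly p) = degree p"
  by (rule degree_map_poly) auto

lemma zeros_cpoly_root_poly:
  "finite I \<Longrightarrow> zeros (cpoly (root_poly x I)) = image_mset x (mset_set I)"
proof (induction I rule: finite_induct)
  case (insert i I)
  have nz: "(\<Prod>i\<in>I. [:- complex_of_real (x i), 1:]) \<noteq> 0"
    using insert(1) by (simp add: prod_zero_iff)
  have "proots ([:- complex_of_real (x i), 1:] * (\<Prod>i\<in>I. [:- complex_of_real (x i), 1:]))
      = proots [:- complex_of_real (x i), 1:] + proots (\<Prod>i\<in>I. [:- complex_of_real (x i), 1:])"
    by (rule proots_mult) (use nz in auto)
  then show ?case using insert
    by (simp add: zeros_def cpoly_root_poly del: mult_pCons_left)
qed (simp add: zeros_def root_poly_def)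

lemma hyperbolic_cpoly_root_poly: "cpoly (root_poly x {..<n}) \<in> hyperbolic n"
proof -
  have "lead_coeff (cpoly (root_poly x {..<n})) = 1"
    using lead_coeff_root_poly[of x "{..<n}"] by (simp add: degree_cpoly coeff_cpoly)
  moreover have "z \<in> \<real>" if "poly (cpoly (root_poly x {..<n})) z = 0" for z
    using that by (auto simp: cpoly_root_poly poly_prod)
  ultimately show ?thesis
    by (simp add: hyperbolic_def degree_cpoly degree_root_poly)
qed

lemma hyperbolicE:
  assumes "P \<in> hyperbolic n"
  obtains x where "P = cpoly (root_poly x {..<n})" "\<And>i j. i \<le> j \<Longrightarrow> j < n \<Longrightarrow> x i \<le> x j"
proof -
  define xs where "xs = sorted_list_of_multiset (zeros P)"
  have P: "lead_coeff P = 1" "degree P = n" "\<And>z. poly P z = 0 \<Longrightarrow> z \<in> \<real>"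
    using assms by (auto simp: hyperbolic_def)
  have "P \<noteq> 0" using P by auto
  have xs: "mset xs = zeros P" by (simp add: xs_def)
  have "size (mset xs) = n"
    unfolding xs zeros_def using size_proots_complex[of P] P by simp
  then have len: "length xs = n" by simp
  have "P = (\<Prod>z\<in>#proots P. [:- z, 1:])"
    using complex_poly_decompose_multiset[of P] P(1) by simp
  also have "\<dots> = (\<Prod>z\<in>#proots P. [:- complex_of_real (Re z), 1:])"
  proof (intro arg_cong[where f = prod_mset] image_mset_cong)
    fix z assume "z \<in># proots P"
    then have "z \<in> \<real>" using P(3) \<open>P \<noteq> 0\<close> by simp
    then show "[:- z, 1:] = [:- complex_of_real (Re z), 1:]" by simp
  qed
  also have "\<dots> = (\<Prod>x\<in>#zeros P. [:- complex_of_real x, 1:])"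
    by (simp add: zeros_def image_mset.compositionality comp_def)
  also have "\<dots> = (\<Prod>x\<leftarrow>xs. [:- complex_of_real x, 1:])"
    by (simp add: prod_mset_prod_list flip: xs mset_map)
  also have "\<dots> = (\<Prod>i<n. [:- complex_of_real (xs ! i), 1:])"
    using len by (simp add: prod.list_conv_set_nth atLeast0LessThan)
  finally have "P = cpoly (root_poly (\<lambda>i. xs ! i) {..<n})"
    by (simp add: cpoly_root_poly)
  moreover have "sorted xs" by (simp add: xs_def)
  ultimately show thesis using that[of "\<lambda>i. xs ! i"] len by (auto simp: sorted_nth_mono)
qed

lemma spectral_le_root_poly:
  assumes "finite I"
  shows "spectral_le (cpoly (root_poly x I)) (cpoly (root_poly y I)) \<longleftrightarrow>
    (\<forall>f. convex_on UNIV f \<longrightarrow> (\<Sum>i\<in>I. f (x i)) \<le> (\<Sum>i\<in>I. f (y i)))"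
  using assms
  by (simp add: spectral_le_def spectral_prec_def zeros_cpoly_root_poly sum_unfold_sum_mset
      image_mset.compositionality comp_def)

lemma spectral_le_refl: "spectral_le P P"
  by (simp add: spectral_le_def spectral_prec_def)

lemma spectral_le_trans: "spectral_le P Q \<Longrightarrow> spectral_le Q R \<Longrightarrow> spectral_le P R"
  unfolding spectral_le_def spectral_prec_def using order_trans by (metis (no_types, lifting))

text \<open>Polymorphic, because sign arguments use the operator on real polynomials while
  \<open>hyperbolic\<close> speaks of complex ones; \<open>cpoly_lin_op\<close> links the
  two.\<close>

definition lin_op :: "real \<Rightarrow> real \<Rightarrow> 'a::real_normed_field poly \<Rightarrow> 'a poly" where
  "lin_op a b P = smult (of_real a) P + smult (of_real b) (pderiv P)"

lemma cpoly_lin_op: "cpoly (lin_op a b p) = lin_op a b (cpoly p)"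
  by (simp add: lin_op_def cpoly_add cpoly_smult cpoly_pderiv)

lemma coeff_lin_op:
  "coeff (lin_op a b P) k = of_real a * coeff P k + of_real b * (of_nat (Suc k) * coeff P (Suc k))"
  by (simp add: lin_op_def coeff_pderiv)

lemma lin_op_add_smult: "lin_op a b (p + smult c q) = lin_op a b p + smult c (lin_op a b q)"
  by (simp add: lin_op_def pderiv_add pderiv_smult smult_add_right mult.commute)

text \<open>The normalizations \<open>1 + b D\<close> and \<open>D / n\<close> of \<open>a + b D\<close> that map monic polynomials of degree
  \<open>n\<close> to monic polynomials of degree \<open>N\<close>.\<close>

definition lin_op_degrees :: "real \<Rightarrow> real \<Rightarrow> nat \<Rightarrow> nat \<Rightarrow> bool" where
  "lin_op_degrees a b n N \<longleftrightarrow> a = 1 \<and> N = n \<or> a = 0 \<and> n = Suc N \<and> b = 1 / real n"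

text \<open>The logarithmic derivative is the sum of the terms 1/(z - x_i), each with imaginary part
  -Im z / |z - x_i|^2. The factor \<open>Im z\<close> treats both half-planes at once.\<close>

lemma Im_log_deriv_root_poly:
  assumes "finite I" "I \<noteq> {}" "Im z \<noteq> 0"
  shows "poly (cpoly (root_poly x I)) z \<noteq> 0 \<and>
    Im z * Im (poly (pderiv (cpoly (root_poly x I))) z / poly (cpoly (root_poly x I)) z) < 0"
proof -
  have pos: "Im z * Im (1 / (z - complex_of_real c)) < 0" for c
  proof -
    have "z - complex_of_real c \<noteq> 0" using assms(3) by (auto simp: complex_eq_iff)
    then have "(Re z - c)\<^sup>2 + (Im z)\<^sup>2 > 0" using assms(3) by (simp add: add_nonneg_pos)
    then show ?thesis using assms(3)
      by (simp add: Im_divide divide_neg_pos power2_eq_square mult_neg_pos zero_less_mult_iff field_simps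
          flip: power2_eq_square)
  qed
  have nz: "z - complex_of_real c \<noteq> 0" for c using assms(3) by (auto simp: complex_eq_iff)
  show ?thesis using assms(1,2)
  proof (induction I rule: finite_ne_induct)
    case (singleton i)
    then show ?case using pos[of "x i"] nz[of "x i"] by (simp add: cpoly_root_poly pderiv_pCons)
  next
    case (insert i I)
    define u where "u = cpoly (root_poly x I)"
    have eq: "cpoly (root_poly x (insert i I)) = [:- complex_of_real (x i), 1:] * u"
      using insert by (simp add: cpoly_root_poly u_def)
    have u0: "poly u z \<noteq> 0" using insert by (simp add: u_def)
    have "poly (pderiv (cpoly (root_poly x (insert i I)))) z / poly (cpoly (root_poly x (insert i I))) z
        = 1 / (z - complex_of_real (x i)) + poly (pderiv u) z / poly u z"
      unfolding eq pderiv_mult using u0 nz[of "x i"] by (simp add: pderiv_pCons field_simps)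
    moreover have "Im z * Im (poly (pderiv u) z / poly u z) < 0"
      using insert by (simp add: u_def)
    ultimately have "Im z * Im (poly (pderiv (cpoly (root_poly x (insert i I)))) z /
        poly (cpoly (root_poly x (insert i I))) z) < 0"
      using pos[of "x i"] by (simp add: distrib_left)
    moreover have "poly (cpoly (root_poly x (insert i I))) z \<noteq> 0"
      unfolding eq using u0 nz[of "x i"] by simp
    ultimately show ?case by blast
  qed
qed

text \<open>At a nonreal zero, a + b P'/P = 0. The imaginary part of P'/P is nonzero there, so b = 0
  and then a = 0, which \<open>lin_op_degrees\<close> excludes.\<close>

lemma lin_op_hyperbolic:
  assumes "lin_op_degrees a b n N" "P \<in> hyperbolic n"
  shows "lin_op a b P \<in> hyperbolic N"
proof -
  obtain x where x: "P = cpoly (root_poly x {..<n})"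
    using hyperbolicE[OF assms(2)] by blast
  have cP: "coeff P n = 1" "\<And>k. k > n \<Longrightarrow> coeff P k = 0"
    using assms(2) by (auto simp: hyperbolic_def coeff_eq_0)
  have "1 + complex_of_nat N \<noteq> 0" by (metis of_nat_Suc of_nat_neq_0)
  then have cN: "coeff (lin_op a b P) N = 1" and "degree (lin_op a b P) \<le> N"
    using assms(1) cP by (auto simp: coeff_lin_op lin_op_degrees_def intro!: degree_le)
  then have deg: "degree (lin_op a b P) = N" by (metis le_antisym le_degree zero_neq_one)
  moreover have "z \<in> \<real>" if z: "poly (lin_op a b P) z = 0" for z
  proof (rule ccontr)
    assume "z \<notin> \<real>"
    then have im: "Im z \<noteq> 0" by (simp add: complex_is_Real_iff)
    \<comment> \<open>For n = 0 the logarithmic derivative is an empty sum and has no sign, so this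
      case is excluded beforehand.\<close>
    have "n \<noteq> 0"
    proof
      assume "n = 0"
      then have "P = 1" using x by (simp add: root_poly_def)
      then show False using z \<open>n = 0\<close> assms(1) by (auto simp: lin_op_def lin_op_degrees_def)
    qed
    then have *: "poly P z \<noteq> 0" "Im z * Im (poly (pderiv P) z / poly P z) < 0"
      using Im_log_deriv_root_poly[of "{..<n}" z x] im unfolding x by auto
    have eq: "of_real a + of_real b * (poly (pderiv P) z / poly P z) = 0"
      using z *(1) by (simp add: lin_op_def field_simps)
    have "Im (of_real a + of_real b * w) = b * Im w" for w by simp
    then have "b * Im (poly (pderiv P) z / poly P z) = 0" by (metis eq zero_complex.sel(2))
    then have "b = 0" using *(2) by auto
    with eq assms(1) show False by (auto simp: lin_op_degrees_def)
  qed
  ultimately show ?thesis using cN by (simp add: hyperbolic_def)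
qed

lemma root_poly_pair:
  assumes "finite I" "i \<in> I" "j \<in> I" "i \<noteq> j" "z i = m - d" "z j = m + d"
  shows "root_poly z I = [:m\<^sup>2 - d\<^sup>2, - 2 * m, 1:] * root_poly z (I - {i, j})"
proof -
  have "root_poly z I = [:- z i, 1:] * ([:- z j, 1:] * root_poly z (I - {i} - {j}))"
    using assms root_poly_remove[of I i z] root_poly_remove[of "I - {i}" j z] by simp
  moreover have "I - {i} - {j} = I - {i, j}" by auto
  moreover have "[:- z i, 1:] * [:- z j, 1:] = [:m\<^sup>2 - d\<^sup>2, - 2 * m, 1:]"
    unfolding assms(5,6) by (simp add: power2_eq_square algebra_simps)
  ultimately show ?thesis by (metis mult.assoc)
qed

text \<open>In the factor (x - m)^2 - d^2 belonging to the pair, only the constant term depends on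
  \<open>d\<close>.\<close>

lemma root_poly_pinch:
  assumes "finite I" "i \<in> I" "j \<in> I" "i \<noteq> j" "z i = m - d" "z j = m + d"
  shows "root_poly (z(i := m - d', j := m + d')) I
    = root_poly z I + smult (d\<^sup>2 - d'\<^sup>2) (root_poly z (I - {i, j}))"
proof -
  let ?z' = "z(i := m - d', j := m + d')" and ?R = "root_poly z (I - {i, j})"
  have "root_poly ?z' I = [:m\<^sup>2 - d'\<^sup>2, - 2 * m, 1:] * root_poly ?z' (I - {i, j})"
    by (rule root_poly_pair) (use assms in auto)
  also have "root_poly ?z' (I - {i, j}) = ?R"
    by (rule root_poly_cong) auto
  also have "[:m\<^sup>2 - d'\<^sup>2, - 2 * m, 1:] * ?R
      = [:m\<^sup>2 - d\<^sup>2, - 2 * m, 1:] * ?R + smult (d\<^sup>2 - d'\<^sup>2) ?R"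
    by (simp add: algebra_simps flip: smult_add_left)
  also have "[:m\<^sup>2 - d\<^sup>2, - 2 * m, 1:] * ?R = root_poly z I"
    by (rule root_poly_pair[symmetric]) (use assms in auto)
  finally show ?thesis .
qed

text \<open>The generic case, in which all inequalities are strict: simple zeros make the Laguerre
  expression positive, \<open>tm\<close> keeps the zeros of g away from \<open>m\<close>, and
  \<open>tm\<close> together with d' > 0 gives g and the perturbed g the same nonzero sign at
  \<open>m\<close>. Perturbation removes these assumptions later.\<close>

lemma lin_op_pinch_generic:
  assumes ok: "lin_op_degrees a b n N" and b: "b \<noteq> 0"
    and ij: "i < n" "j < n" "i \<noteq> j" and inj: "inj_on z {..<n}"
    and z: "z i = m - d" "z j = m + d" and d: "0 < d'" "d' < d"
    and tm: "poly (lin_op a b (root_poly z ({..<n} - {i, j}))) m \<noteq> 0"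
  shows "spectral_le (lin_op a b (cpoly (root_poly (z(i := m - d', j := m + d')) {..<n})))
    (lin_op a b (cpoly (root_poly z {..<n})))"
proof -
  define R where "R = root_poly z ({..<n} - {i, j})"
  define p where "p = root_poly z {..<n}"
  define z' where "z' = z(i := m - d', j := m + d')"
  define g where "g = lin_op a b p"
  define \<eta> where "\<eta> = d\<^sup>2 - d'\<^sup>2"
  define t where "t = lin_op a b R"
  have \<eta>: "\<eta> > 0" using d by (simp add: \<eta>_def power_strict_mono)
  have p: "p = [:m\<^sup>2 - d\<^sup>2, - 2 * m, 1:] * R"
    unfolding p_def R_def by (rule root_poly_pair) (use ij z in auto)
  have p': "root_poly z' {..<n} = p + smult \<eta> R"
    unfolding z'_def p_def \<eta>_def R_def by (rule root_poly_pinch) (use ij z in auto)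
  have G: "lin_op a b (root_poly z' {..<n}) = g + smult \<eta> t"
    unfolding p' g_def t_def by (rule lin_op_add_smult)
  have degR: "degree R = n - 2"
    unfolding R_def using ij by (simp add: degree_root_poly card_Diff_subset)
  have L: "laguerre_expr p w > 0" for w
    unfolding p_def by (rule laguerre_expr_pos) (use ij inj in auto)
  have gw: "poly g w = a * poly p w + b * poly (pderiv p) w" for w
    by (simp add: g_def lin_op_def)
  have g'w: "poly (pderiv g) w = a * poly (pderiv p) w + b * poly (pderiv (pderiv p)) w" for w
    by (simp add: g_def lin_op_def pderiv_add pderiv_smult)
  have tw: "poly t w = a * poly R w + b * poly (pderiv R) w" for w
    by (simp add: t_def lin_op_def)
  have pw: "poly p w = ((w - m)\<^sup>2 - d\<^sup>2) * poly R w" for w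
    unfolding p by (simp add: power2_eq_square algebra_simps)
  have p'w: "poly (pderiv p) w = 2 * (w - m) * poly R w + ((w - m)\<^sup>2 - d\<^sup>2) * poly (pderiv R) w" for w
    unfolding p pderiv_mult by (simp add: pderiv_pCons power2_eq_square algebra_simps)
  \<comment> \<open>The quadratic factor of \<open>p\<close> has value -d^2 and derivative 0 at
    \<open>m\<close>, so T acts there on \<open>R\<close> alone.\<close>
  have gm: "poly g m = - d\<^sup>2 * poly t m"
    unfolding gw tw pw p'w by (simp add: algebra_simps)
  have root: "(w - m) * poly t w * poly (pderiv g) w > 0" if "poly g w = 0" for w
  proof -
    have p0: "poly p w \<noteq> 0"
    proof
      assume "poly p w = 0"
      then have "poly (pderiv p) w = 0" using that b gw by simp
      with L[of w] \<open>poly p w = 0\<close> show False by (simp add: laguerre_expr_def)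
    qed
    have "w \<noteq> m"
    proof
      assume "w = m"
      then have "d\<^sup>2 * poly t m = 0" using that gm by simp
      then show False using d tm by (simp add: t_def R_def)
    qed
    \<comment> \<open>The equation g(w) = 0 eliminates \<open>a\<close>. It turns p g' into -b times
      the Laguerre expression and p t into -2 b (w - m) R^2; multiplying the two with w - m yields a
      positive quantity.\<close>
    have e: "a * poly p w = - b * poly (pderiv p) w" using that gw[of w] by simp
    have "poly p w * poly (pderiv g) w = - b * laguerre_expr p w"
    proof -
      have "poly p w * poly (pderiv g) w = (a * poly p w) * poly (pderiv p) w
          + b * poly p w * poly (pderiv (pderiv p)) w"
        unfolding g'w by (simp add: algebra_simps)
      then show ?thesis unfolding e by (simp add: laguerre_expr_def power2_eq_square algebra_simps)
    qed
    moreover have "poly p w * poly t w = - b * (2 * (w - m) * (poly R w)\<^sup>2)"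
    proof -
      have "poly p w * poly t w = poly R w * (a * poly p w + b * (((w - m)\<^sup>2 - d\<^sup>2) * poly (pderiv R) w))"
        unfolding tw pw by (simp add: algebra_simps)
      then show ?thesis unfolding e unfolding p'w by (simp add: power2_eq_square algebra_simps)
    qed
    moreover have "(poly p w)\<^sup>2 * ((w - m) * poly t w * poly (pderiv g) w)
        = (w - m) * ((poly p w * poly t w) * (poly p w * poly (pderiv g) w))"
      by (simp add: power2_eq_square algebra_simps)
    ultimately have "(poly p w)\<^sup>2 * ((w - m) * poly t w * poly (pderiv g) w)
        = (w - m) * ((- b * (2 * (w - m) * (poly R w)\<^sup>2)) * (- b * laguerre_expr p w))"
      by (simp only:)
    also have "\<dots> = 2 * (b * (w - m) * poly R w)\<^sup>2 * laguerre_expr p w"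
      by (simp add: power2_eq_square)
    finally have "(poly p w)\<^sup>2 * ((w - m) * poly t w * poly (pderiv g) w)
        = 2 * (b * (w - m) * poly R w)\<^sup>2 * laguerre_expr p w" .
    moreover have "2 * (b * (w - m) * poly R w)\<^sup>2 * laguerre_expr p w > 0"
      using L[of w] b \<open>w \<noteq> m\<close> p0 pw[of w] by (intro mult_pos_pos) auto
    ultimately show ?thesis using p0
      by (metis zero_less_mult_pos zero_less_power2)
  qed
  have "cpoly g \<in> hyperbolic N"
    unfolding g_def cpoly_lin_op p_def
    by (rule lin_op_hyperbolic[OF ok hyperbolic_cpoly_root_poly])
  then obtain y where y: "cpoly g = cpoly (root_poly y {..<N})"
      and ymono: "\<And>i j. i \<le> j \<Longrightarrow> j < N \<Longrightarrow> y i \<le> y j"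
    using hyperbolicE by blast
  have g: "g = root_poly y {..<N}" using y by (simp add: cpoly_inject)
  \<comment> \<open>At a double zero the derivative of \<open>g\<close> would vanish, contrary to
    the strict inequality in \<open>root\<close>.\<close>
  have strict: "y i < y j" if "i < j" "j < N" for i j
  proof (rule ccontr)
    assume "\<not> y i < y j"
    then have eq: "y i = y j" using ymono[of i j] that by auto
    have "g = [:- y j, 1:] * ([:- y i, 1:] * root_poly y ({..<N} - {j} - {i}))"
      unfolding g using that root_poly_remove[of "{..<N}" j y] root_poly_remove[of "{..<N} - {j}" i y]
      by simp
    then have "poly (pderiv g) (y j) = 0" using eq
      by (simp add: pderiv_mult pderiv_pCons del: mult_pCons_left)
    moreover have "poly g (y j) = 0" unfolding g using that by (simp add: poly_root_poly_eq_0_iff)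
    ultimately show False using root[of "y j"] by simp
  qed
  obtain y' where y': "g + smult \<eta> t = smult 1 (root_poly y' {..<N})"
      "(\<Sum>j<N. y' j) = (\<Sum>j<N. y j)" "\<And>j. j < N \<Longrightarrow> y' j \<in> closed_segment m (y j)"
  proof (rule roots_move_towards[where g = g and l = 1 and y = y and N = N and m = m and t = "smult \<eta> t"])
    show "(y j - m) * poly (smult \<eta> t) (y j) * poly (pderiv g) (y j) > 0" if "j < N" for j
    proof -
      have "poly g (y j) = 0" unfolding g using that by (simp add: poly_root_poly_eq_0_iff)
      then have "\<eta> * ((y j - m) * poly t (y j) * poly (pderiv g) (y j)) > 0"
        using root \<eta> by simp
      then show ?thesis by (simp add: algebra_simps)
    qed
    \<comment> \<open>By \<open>gm\<close> the values at \<open>m\<close> are -d^2 t(m) and, after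
      adding \<open>\<eta>\<close> t(m), -d'^2 t(m).\<close>
    have "poly g m * poly (g + smult \<eta> t) m = (d * d' * poly t m)\<^sup>2"
      by (simp add: gm \<eta>_def power2_eq_square algebra_simps)
    then show "poly g m * poly (g + smult \<eta> t) m > 0"
      using d tm by (simp add: t_def R_def)
    \<comment> \<open>\<open>R\<close> has degree n - 2. In both cases of
      \<open>lin_op_degrees\<close> its image has no terms of order N - 1 or higher: for a = 0 both
      \<open>N\<close> and the degree of the image drop by one.\<close>
    show "coeff (smult \<eta> t) k = 0" if "N \<le> Suc k" for k
      using ok that ij degR by (auto simp: t_def coeff_lin_op lin_op_degrees_def coeff_eq_0)
  qed (use g strict in auto)
  have "spectral_le (cpoly (root_poly y' {..<N})) (cpoly (root_poly y {..<N}))"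
    unfolding spectral_le_root_poly[OF finite_lessThan]
    using convex_sum_le_towards[of _ y' "{..<N}" y m] y' by auto
  moreover have "lin_op a b (cpoly (root_poly z' {..<n})) = cpoly (root_poly y' {..<N})"
    using y'(1) by (simp add: G flip: cpoly_lin_op)
  moreover have "lin_op a b (cpoly (root_poly z {..<n})) = cpoly (root_poly y {..<N})"
    using y by (simp add: g_def p_def flip: cpoly_lin_op)
  ultimately show ?thesis by (simp add: z'_def)
qed

subsection \<open>Limits and majorization\<close>

lemma simultaneous_convergent_subsequence:
  fixes X :: "nat \<Rightarrow> nat \<Rightarrow> real"
  assumes "\<And>i k. i < n \<Longrightarrow> \<bar>X k i\<bar> \<le> K"
  obtains r l where "strict_mono r" "\<And>i. i < n \<Longrightarrow> (\<lambda>k. X (r k) i) \<longlonglongrightarrow> l i"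
proof -
  have "\<exists>r l. strict_mono r \<and> (\<forall>i<n. (\<lambda>k. X (r k) i) \<longlonglongrightarrow> l i)"
    using assms
  proof (induction n)
    case 0
    then show ?case by (auto intro: exI[of _ id] simp: strict_mono_id)
  next
    case (Suc n)
    then obtain r l where r: "strict_mono r" "\<And>i. i < n \<Longrightarrow> (\<lambda>k. X (r k) i) \<longlonglongrightarrow> l i"
      by (metis less_SucI)
    have "bounded (range (\<lambda>k. X (r k) n))"
      using Suc.prems by (intro boundedI[of _ K]) auto
    then obtain s c where s: "strict_mono s" "((\<lambda>k. X (r k) n) \<circ> s) \<longlonglongrightarrow> c"
      using bounded_imp_convergent_subsequence by metis
    have "(\<lambda>k. X ((r \<circ> s) k) i) \<longlonglongrightarrow> (l(n := c)) i" if "i < Suc n" for i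
    proof (cases "i = n")
      case False
      then show ?thesis using LIMSEQ_subseq_LIMSEQ[OF r(2)[of i] s(1)] that by (simp add: comp_def)
    qed (use s in \<open>simp add: comp_def\<close>)
    moreover have "strict_mono (r \<circ> s)" using r s by (simp add: strict_mono_o)
    ultimately show ?case by blast
  qed
  then show thesis using that by blast
qed

text \<open>A Cauchy-type bound: for |z| > 1, the equation p(z) = 0 expresses z^n by n lower terms,
  each at most K |z|^(n - 1) in absolute value.\<close>

lemma root_bound_by_coeffs:
  assumes "\<And>k. \<bar>coeff (root_poly x {..<n}) k\<bar> \<le> K" "i < n"
  shows "\<bar>x i\<bar> \<le> 1 + real n * K"
proof -
  define p where "p = root_poly x {..<n}"
  let ?z = "x i"
  have "K \<ge> 0" using assms(1)[of 0] by linarith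
  show ?thesis
  proof (cases "\<bar>?z\<bar> \<le> 1")
    case True
    then show ?thesis using \<open>K \<ge> 0\<close> by (simp add: add_increasing2)
  next
    case False
    have deg: "degree p = n" by (simp add: p_def degree_root_poly)
    have "0 = poly p ?z" using assms(2) by (simp add: p_def poly_root_poly_eq_0_iff)
    also have "\<dots> = (\<Sum>k<n. coeff p k * ?z ^ k) + ?z ^ n"
      using lead_coeff_root_poly[of x "{..<n}"] deg
      by (simp add: poly_altdef p_def flip: lessThan_Suc_atMost)
    finally have "?z ^ n = - (\<Sum>k<n. coeff p k * ?z ^ k)" by simp
    then have "\<bar>?z\<bar> ^ n = \<bar>\<Sum>k<n. coeff p k * ?z ^ k\<bar>"
      by (metis abs_minus_cancel power_abs)
    also have "\<dots> \<le> (\<Sum>k<n. K * \<bar>?z\<bar> ^ (n - 1))"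
    proof (rule order_trans[OF sum_abs sum_mono])
      fix k assume "k \<in> {..<n}"
      then have "\<bar>?z\<bar> ^ k \<le> \<bar>?z\<bar> ^ (n - 1)" using False by (intro power_increasing) auto
      then show "\<bar>coeff p k * ?z ^ k\<bar> \<le> K * \<bar>?z\<bar> ^ (n - 1)"
        using assms(1)[of k] by (auto simp: abs_mult power_abs p_def intro!: mult_mono)
    qed
    finally have "\<bar>?z\<bar> * \<bar>?z\<bar> ^ (n - 1) \<le> (real n * K) * \<bar>?z\<bar> ^ (n - 1)"
      using assms(2) by (simp flip: power_Suc add: mult.assoc)
    moreover have "0 < \<bar>?z\<bar> ^ (n - 1)" using False by (intro zero_less_power) auto
    ultimately have "\<bar>?z\<bar> \<le> real n * K" by (rule mult_right_le_imp_le)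
    then show ?thesis by simp
  qed
qed

lemma tendsto_coeff_root_poly:
  assumes "\<And>i. i < n \<Longrightarrow> ((\<lambda>k. x k i) \<longlongrightarrow> l i) F"
  shows "((\<lambda>k. coeff (root_poly (x k) {..<n}) j) \<longlongrightarrow> coeff (root_poly l {..<n}) j) F"
  using assms
proof (induction n arbitrary: j)
  case (Suc n)
  have eq: "coeff (root_poly w {..<Suc n}) j = - w n * coeff (root_poly w {..<n}) j +
      (if j = 0 then 0 else coeff (root_poly w {..<n}) (j - 1))" for w
    unfolding lessThan_Suc by (subst root_poly_insert) (auto simp: coeff_pCons split: nat.split)
  have "((\<lambda>k. coeff (root_poly (x k) {..<n}) j) \<longlongrightarrow> coeff (root_poly l {..<n}) j) F" for j
    using Suc by simp
  then show ?case unfolding eq using Suc.prems[of n] by (auto intro!: tendsto_intros)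
qed (simp add: root_poly_def)

text \<open>Convergent coefficients are bounded, hence so are the zeros, and a subsequence of the
  tuples of zeros converges. Its limit must be a tuple of zeros of the limit polynomial, and convex
  functions on the line are continuous, so the inequalities between sums pass to the limit.\<close>

lemma hyperbolic_spectral_le_limit:
  assumes "\<And>k. P k \<in> hyperbolic n" "\<And>k. Q k \<in> hyperbolic n" "\<And>k. spectral_le (Q k) (P k)"
    and "\<And>j. (\<lambda>k. coeff (P k) j) \<longlonglongrightarrow> coeff P' j" "\<And>j. (\<lambda>k. coeff (Q k) j) \<longlonglongrightarrow> coeff Q' j"
  shows "P' \<in> hyperbolic n" "Q' \<in> hyperbolic n" "spectral_le Q' P'"
proof -
  have bdd: "\<exists>x K. (\<forall>k. R k = cpoly (root_poly (x k) {..<n})) \<and> (\<forall>k. \<forall>i<n. \<bar>x k i\<bar> \<le> K)"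
    if R: "\<And>k. R k \<in> hyperbolic n" and lim: "\<And>j. (\<lambda>k. coeff (R k) j) \<longlonglongrightarrow> coeff R' j" for R R'
  proof -
    have "\<exists>x. R k = cpoly (root_poly x {..<n})" for k
      using hyperbolicE[OF R] by metis
    then obtain x where x: "\<And>k. R k = cpoly (root_poly (x k) {..<n})"
      by metis
    have "\<exists>C. \<forall>k. norm (coeff (R k) j) \<le> C" for j
      using convergent_imp_Bseq[OF convergentI[OF lim[of j]]] by (auto simp: Bseq_def)
    then obtain C where C: "\<And>j k. norm (coeff (R k) j) \<le> C j" by metis
    have "\<bar>coeff (root_poly (x k) {..<n}) j\<bar> \<le> (\<Sum>j\<le>n. C j)" for k j
    proof (cases "j \<le> n")
      case True
      have "\<bar>coeff (root_poly (x k) {..<n}) j\<bar> = norm (coeff (R k) j)"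
        by (simp add: x coeff_cpoly)
      also have "\<dots> \<le> C j" by (rule C)
      also have "\<dots> \<le> (\<Sum>j\<le>n. C j)"
        using True order_trans[OF norm_ge_zero C] by (intro member_le_sum) auto
      finally show ?thesis .
    next
      case False
      then have "coeff (root_poly (x k) {..<n}) j = 0"
        by (intro coeff_eq_0) (simp add: degree_root_poly)
      then show ?thesis using order_trans[OF norm_ge_zero C] by (simp add: sum_nonneg)
    qed
    then have "\<bar>x k i\<bar> \<le> 1 + real n * (\<Sum>j\<le>n. C j)" if "i < n" for k i
      using root_bound_by_coeffs that by blast
    then show ?thesis using x by blast
  qed
  obtain x K where x: "\<And>k. P k = cpoly (root_poly (x k) {..<n})" "\<And>k i. i < n \<Longrightarrow> \<bar>x k i\<bar> \<le> K"
    using bdd[OF assms(1,4)] by metis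
  obtain y K' where y: "\<And>k. Q k = cpoly (root_poly (y k) {..<n})" "\<And>k i. i < n \<Longrightarrow> \<bar>y k i\<bar> \<le> K'"
    using bdd[OF assms(2,5)] by metis
  obtain r u where r: "strict_mono r" "\<And>i. i < n \<Longrightarrow> (\<lambda>k. x (r k) i) \<longlonglongrightarrow> u i"
    using simultaneous_convergent_subsequence[of n x K] x(2) by metis
  \<comment> \<open>The second extraction is made inside the first, so that both tuples converge
    along r o s.\<close>
  obtain s v where s: "strict_mono s" "\<And>i. i < n \<Longrightarrow> (\<lambda>k. y (r (s k)) i) \<longlonglongrightarrow> v i"
    using simultaneous_convergent_subsequence[of n "\<lambda>k. y (r k)" K'] y(2) by metis
  have xu: "(\<lambda>k. x (r (s k)) i) \<longlonglongrightarrow> u i" if "i < n" for i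
    using LIMSEQ_subseq_LIMSEQ[OF r(2)[OF that] s(1)] by (simp add: comp_def)
  have rs: "strict_mono (r \<circ> s)" using r(1) s(1) by (rule strict_mono_o)
  have P': "P' = cpoly (root_poly u {..<n})"
  proof (rule poly_eqI)
    fix j
    have "(\<lambda>k. coeff (P (r (s k))) j) \<longlonglongrightarrow> coeff P' j"
      using LIMSEQ_subseq_LIMSEQ[OF assms(4) rs] by (simp add: comp_def)
    moreover have "(\<lambda>k. coeff (P (r (s k))) j) \<longlonglongrightarrow> coeff (cpoly (root_poly u {..<n})) j"
      unfolding x coeff_cpoly by (intro tendsto_of_real tendsto_coeff_root_poly xu)
    ultimately show "coeff P' j = coeff (cpoly (root_poly u {..<n})) j"
      by (rule LIMSEQ_unique)
  qed
  have Q': "Q' = cpoly (root_poly v {..<n})"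
  proof (rule poly_eqI)
    fix j
    have "(\<lambda>k. coeff (Q (r (s k))) j) \<longlonglongrightarrow> coeff Q' j"
      using LIMSEQ_subseq_LIMSEQ[OF assms(5) rs] by (simp add: comp_def)
    moreover have "(\<lambda>k. coeff (Q (r (s k))) j) \<longlonglongrightarrow> coeff (cpoly (root_poly v {..<n})) j"
      unfolding y coeff_cpoly by (intro tendsto_of_real tendsto_coeff_root_poly s)
    ultimately show "coeff Q' j = coeff (cpoly (root_poly v {..<n})) j"
      by (rule LIMSEQ_unique)
  qed
  show "P' \<in> hyperbolic n" "Q' \<in> hyperbolic n"
    unfolding P' Q' by (rule hyperbolic_cpoly_root_poly)+
  have "(\<Sum>i<n. f (v i)) \<le> (\<Sum>i<n. f (u i))" if f: "convex_on UNIV f" for f :: "real \<Rightarrow> real"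
  proof -
    have "isCont f w" for w
      using convex_on_continuous[OF open_UNIV f] by (simp add: continuous_on_eq_continuous_at)
    then have lim: "(\<lambda>k. f (g k)) \<longlonglongrightarrow> f w" if "g \<longlonglongrightarrow> w" for g w
      using that isCont_tendsto_compose by blast
    show ?thesis
    proof (rule LIMSEQ_le)
      show "(\<lambda>k. \<Sum>i<n. f (y (r (s k)) i)) \<longlonglongrightarrow> (\<Sum>i<n. f (v i))"
        by (intro tendsto_sum lim s) auto
      show "(\<lambda>k. \<Sum>i<n. f (x (r (s k)) i)) \<longlonglongrightarrow> (\<Sum>i<n. f (u i))"
        by (intro tendsto_sum lim xu) auto
      have "(\<Sum>i<n. f (y k i)) \<le> (\<Sum>i<n. f (x k i))" for k
        using assms(3)[of k] f unfolding x y spectral_le_root_poly[OF finite_lessThan] by blast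
      then show "\<exists>N. \<forall>k\<ge>N. (\<Sum>i<n. f (y (r (s k)) i)) \<le> (\<Sum>i<n. f (x (r (s k)) i))" by blast
    qed
  qed
  then show "spectral_le Q' P'" unfolding P' Q' spectral_le_root_poly[OF finite_lessThan] by blast
qed

section \<open>Operators preserving real zeros and the spectral order\<close>

definition isotonic :: "nat \<Rightarrow> nat \<Rightarrow> (complex poly \<Rightarrow> complex poly) \<Rightarrow> bool" where
  "isotonic n N T \<longleftrightarrow> (\<forall>P\<in>hyperbolic n. T P \<in> hyperbolic N) \<and>
    (\<forall>P\<in>hyperbolic n. \<forall>Q\<in>hyperbolic n. spectral_le Q P \<longrightarrow> spectral_le (T Q) (T P))"

lemma isotonic_compose: "isotonic n N T \<Longrightarrow> isotonic N M S \<Longrightarrow> isotonic n M (\<lambda>P. S (T P))"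
  by (simp add: isotonic_def)

lemma isotonic_id: "isotonic n n (\<lambda>P. P)"
  by (simp add: isotonic_def)

lemma isotonic_cong:
  "isotonic n N S \<Longrightarrow> (\<And>P. P \<in> hyperbolic n \<Longrightarrow> T P = S P) \<Longrightarrow> isotonic n N T"
  by (simp add: isotonic_def)

lemma isotonic_limit:
  assumes "\<And>k. isotonic n N (T k)"
    and "\<And>P j. P \<in> hyperbolic n \<Longrightarrow> (\<lambda>k. coeff (T k P) j) \<longlonglongrightarrow> coeff (S P) j"
  shows "isotonic n N S"
  unfolding isotonic_def
proof (intro conjI ballI impI)
  \<comment> \<open>The limit lemma is applied to the constant comparison of each image with
    itself.\<close>
  show "S P \<in> hyperbolic N" if "P \<in> hyperbolic n" for P
    by (rule hyperbolic_spectral_le_limit(1)[of "\<lambda>k. T k P" N "\<lambda>k. T k P" _ "S P"])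
       (use assms that in \<open>auto simp: isotonic_def spectral_le_refl\<close>)
  show "spectral_le (S Q) (S P)"
    if "P \<in> hyperbolic n" "Q \<in> hyperbolic n" "spectral_le Q P" for P Q
    by (rule hyperbolic_spectral_le_limit(3)[of "\<lambda>k. T k P" N "\<lambda>k. T k Q"])
       (use assms that in \<open>auto simp: isotonic_def\<close>)
qed

text \<open>Muirhead's and Hardy-Littlewood-Polya's argument: \<open>j\<close> is the first index with \<open>x j < y j\<close>, so
  all partial sums up to \<open>j\<close> have enough slack for moving mass from \<open>j\<close> to an index \<open>i < j\<close>.\<close>

lemma majorization_induct:
  fixes x y :: "nat \<Rightarrow> real"
  assumes sorted: "\<And>i j. i \<le> j \<Longrightarrow> j < n \<Longrightarrow> x i \<le> x j"
    and part: "\<And>k. k \<le> n \<Longrightarrow> (\<Sum>i<k. y i) \<le> (\<Sum>i<k. x i)"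
    and total: "(\<Sum>i<n. y i) = (\<Sum>i<n. x i)"
    and refl: "\<And>y. (\<And>i. i < n \<Longrightarrow> y i = x i) \<Longrightarrow> \<Phi> y"
    and step: "\<And>y i j \<delta>. \<lbrakk>i < j; j < n; 0 \<le> \<delta>; y i + \<delta> \<le> y j - \<delta>;
      \<Phi> (y(i := y i + \<delta>, j := y j - \<delta>))\<rbrakk> \<Longrightarrow> \<Phi> y"
  shows "\<Phi> y"
  using part total
proof (induction "card {i. i < n \<and> y i \<noteq> x i}" arbitrary: y rule: less_induct)
  case less
  show ?case
  proof (cases "\<forall>i<n. y i = x i")
    case True
    then show ?thesis using refl by blast
  next
    case False
    have "\<exists>j<n. x j < y j"
    proof (rule ccontr)
      assume "\<not> ?thesis"
      then have le: "\<forall>i\<in>{..<n}. y i \<le> x i" by auto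
      obtain i where "i < n" "y i \<noteq> x i" using False by blast
      then have "\<exists>i\<in>{..<n}. y i < x i" using le by force
      then have "(\<Sum>i<n. y i) < (\<Sum>i<n. x i)" using le by (intro sum_strict_mono_ex1) auto
      then show False using less.prems(2) by simp
    qed
    then obtain j where j: "j < n" "x j < y j" and least: "\<And>i. i < j \<Longrightarrow> \<not> (i < n \<and> x i < y i)"
      using exists_least_iff[of "\<lambda>j. j < n \<and> x j < y j"] by blast
    have below: "y i \<le> x i" if "i < j" for i using least[OF that] that j by auto
    \<comment> \<open>Without such an index, the excess at \<open>j\<close> would violate the bound
      on the first \<open>Suc j\<close> terms.\<close>
    have "\<exists>i<j. y i < x i"
    proof (rule ccontr)
      assume "\<not> ?thesis"
      then have "x l \<le> y l" if "l < j" for l using that not_less by blast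
      then have "(\<Sum>i<j. x i) \<le> (\<Sum>i<j. y i)" by (intro sum_mono) auto
      moreover have "(\<Sum>i<Suc j. y i) \<le> (\<Sum>i<Suc j. x i)"
        using less.prems(1)[of "Suc j"] j by auto
      ultimately show False using j by simp
    qed
    then obtain i where i: "i < j" "y i < x i" by blast
    \<comment> \<open>The largest transfer that overshoots neither target. It makes the tuples agree
      at \<open>i\<close> or at \<open>j\<close>, which lowers the number of disagreements, the
      measure of the induction.\<close>
    define \<delta> where "\<delta> = min (x i - y i) (y j - x j)"
    have \<delta>: "\<delta> > 0" "y i + \<delta> \<le> x i" "x j \<le> y j - \<delta>" using i j by (auto simp: \<delta>_def)
    define y' where "y' = y(i := y i + \<delta>, j := y j - \<delta>)"
    have y': "y' l = y l + (if l = i then \<delta> else 0) - (if l = j then \<delta> else 0)" for l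
      using i by (auto simp: y'_def)
    have S: "(\<Sum>l<k. y' l) = (\<Sum>l<k. y l) + (if i < k then \<delta> else 0) - (if j < k then \<delta> else 0)" for k
      unfolding y' by (simp add: sum.distrib sum_subtractf sum.delta)
    have "\<Phi> y'"
    proof (rule less.hyps)
      have sub: "{l. l < n \<and> y' l \<noteq> x l} \<subseteq> {l. l < n \<and> y l \<noteq> x l}"
        using i j by (auto simp: y'_def)
      moreover have "y' i = x i \<or> y' j = x j"
        using i by (auto simp: y'_def \<delta>_def min_def)
      then have "{l. l < n \<and> y' l \<noteq> x l} \<noteq> {l. l < n \<and> y l \<noteq> x l}"
        using i j by force
      ultimately show "card {l. l < n \<and> y' l \<noteq> x l} < card {l. l < n \<and> y l \<noteq> x l}"
        by (intro psubset_card_mono) auto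
      show "(\<Sum>l<n. y' l) = (\<Sum>l<n. x l)" using S[of n] i j less.prems(2) by auto
      show "(\<Sum>l<k. y' l) \<le> (\<Sum>l<k. x l)" if "k \<le> n" for k
      \<comment> \<open>Only partial sums containing \<open>i\<close> but not \<open>j\<close> grow,
        by \<delta> \<le> x i - y i. The term of index \<open>i\<close> absorbs this, since the
        other terms below \<open>j\<close> satisfy y \<le> x.\<close>
      proof (cases "i < k \<and> k \<le> j")
        case True
        have "(\<Sum>l<k. y l) + (x i - y i) = (\<Sum>l\<in>{..<k} - {i}. y l) + x i"
          using True by (simp add: sum.remove[of _ i])
        also have "\<dots> \<le> (\<Sum>l\<in>{..<k} - {i}. x l) + x i"
          using below True by (intro add_right_mono sum_mono) auto
        also have "\<dots> = (\<Sum>l<k. x l)" using True by (simp add: sum.remove[of _ i])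
        finally show ?thesis using S[of k] True \<delta> by auto
      next
        case False
        then show ?thesis using S[of k] less.prems(1)[OF that] i by (auto split: if_splits)
      qed
    qed
    moreover have "y i + \<delta> \<le> y j - \<delta>" using \<delta> sorted[of i j] i j by simp
    ultimately show ?thesis
      using step[of i j \<delta> y] i j \<delta> unfolding y'_def by simp
  qed
qed

section \<open>From convex functions to partial sums\<close>

lemma convex_on_max_0_diff: "convex_on UNIV (\<lambda>s::real. max 0 (c - s))"
proof (rule convex_onI)
  fix t x y :: real assume "0 < t" "t < 1"
  then have "(1 - t) * (c - x) \<le> (1 - t) * max 0 (c - x)" "t * (c - y) \<le> t * max 0 (c - y)"
    "0 \<le> (1 - t) * max 0 (c - x)" "0 \<le> t * max 0 (c - y)"
    by (auto intro: mult_left_mono)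
  then show "max 0 (c - ((1 - t) *\<^sub>R x + t *\<^sub>R y)) \<le> (1 - t) * max 0 (c - x) + t * max 0 (c - y)"
    by (intro max.boundedI) (simp_all add: algebra_simps)
qed auto

text \<open>The test function is max 0 (c - s) with \<open>c\<close> the k-th smallest entry of
  \<open>y\<close>. Its sum over \<open>y\<close> is exactly the sum of c - y_i over i < k, while
  its sum over \<open>x\<close> is at least that of c - x_i. The functions s and -s give equal
  totals.\<close>

lemma partial_sums_of_convex_sums:
  fixes x y :: "nat \<Rightarrow> real"
  assumes sorted: "\<And>i j. i \<le> j \<Longrightarrow> j < n \<Longrightarrow> y i \<le> y j"
    and le: "\<And>f. convex_on UNIV f \<Longrightarrow> (\<Sum>i<n. f (x i)) \<le> (\<Sum>i<n. f (y i))"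
  shows "k \<le> n \<Longrightarrow> (\<Sum>i<k. y i) \<le> (\<Sum>i<k. x i)" "(\<Sum>i<n. y i) = (\<Sum>i<n. x i)"
proof -
  have "convex_on UNIV (\<lambda>s::real. s)" "convex_on UNIV (\<lambda>s::real. - s)"
    by (auto intro!: convex_onI simp: algebra_simps)
  from this[THEN le] show "(\<Sum>i<n. y i) = (\<Sum>i<n. x i)" by (simp add: sum_negf)
  show "(\<Sum>i<k. y i) \<le> (\<Sum>i<k. x i)" if k: "k \<le> n"
  proof (cases k)
    case (Suc l)
    define c where "c = y l"
    have "(\<Sum>i<k. c - x i) \<le> (\<Sum>i<k. max 0 (c - x i))" by (intro sum_mono) auto
    also have "\<dots> \<le> (\<Sum>i<n. max 0 (c - x i))" using k by (intro sum_mono2) auto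
    also have "\<dots> \<le> (\<Sum>i<n. max 0 (c - y i))" by (rule le[OF convex_on_max_0_diff])
    also have "\<dots> = (\<Sum>i<k. max 0 (c - y i))"
      using k Suc sorted[of l] by (intro sum.mono_neutral_right) (auto simp: c_def)
    also have "\<dots> = (\<Sum>i<k. c - y i)"
      using sorted[of _ l] k Suc by (intro sum.cong) (auto simp: c_def)
    finally show ?thesis by (simp add: sum_subtractf)
  qed simp
qed

subsection \<open>First-order operators preserve the spectral order\<close>

lemma tendsto_coeff_lin_op:
  assumes "\<And>j. ((\<lambda>k. coeff (P k) j) \<longlongrightarrow> coeff P' j) F"
  shows "((\<lambda>k. coeff (lin_op a b (P k)) j) \<longlongrightarrow> coeff (lin_op a b P') j) F"
  unfolding coeff_lin_op by (intro tendsto_intros assms)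

text \<open>Serves to choose perturbation parameters tending to 0 that avoid finitely many
  degenerate values.\<close>

lemma eventually_inverse_Suc_notin:
  assumes "finite (S :: real set)"
  shows "\<forall>\<^sub>F k in sequentially. inverse (real (Suc k)) \<notin> S"
proof -
  have "\<forall>\<^sub>F k in sequentially. inverse (real (Suc k)) \<noteq> s" for s :: real
  proof (cases "s = 0")
    case False
    then show ?thesis
      by (intro tendsto_imp_eventually_ne[OF LIMSEQ_inverse_real_of_nat]) auto
  qed auto
  then have "\<forall>\<^sub>F k in sequentially. \<forall>s\<in>S. inverse (real (Suc k)) \<noteq> s"
    using assms by (intro eventually_ball_finite) auto
  then show ?thesis by (rule eventually_mono) auto
qed

lemma lin_op_spectral_le_perturb:
  assumes ok: "lin_op_degrees a b n N"
    and ev: "\<forall>\<^sub>F k in sequentially. spectral_le (lin_op a b (cpoly (root_poly (u (inverse (real (Suc k)))) {..<n})))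
        (lin_op a b (cpoly (root_poly (v (inverse (real (Suc k)))) {..<n})))"
    and u: "\<And>i. i < n \<Longrightarrow> ((\<lambda>\<epsilon>. u \<epsilon> i) \<longlongrightarrow> x i) (at 0)"
    and v: "\<And>i. i < n \<Longrightarrow> ((\<lambda>\<epsilon>. v \<epsilon> i) \<longlongrightarrow> y i) (at 0)"
  shows "spectral_le (lin_op a b (cpoly (root_poly x {..<n}))) (lin_op a b (cpoly (root_poly y {..<n})))"
proof -
  obtain K where K: "\<And>k. k \<ge> K \<Longrightarrow> spectral_le (lin_op a b (cpoly (root_poly (u (inverse (real (Suc k)))) {..<n})))
        (lin_op a b (cpoly (root_poly (v (inverse (real (Suc k)))) {..<n})))"
    using ev by (auto simp: eventually_sequentially)
  \<comment> \<open>Shifted by \<open>K\<close> because the limit lemma asks for the comparison at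
    every index.\<close>
  define e where "e k = inverse (real (Suc (k + K)))" for k
  have "e \<longlonglongrightarrow> 0"
    unfolding e_def by (rule LIMSEQ_ignore_initial_segment[OF LIMSEQ_inverse_real_of_nat])
  then have e: "filterlim e (at 0) sequentially"
    by (intro filterlim_atI) (auto simp: e_def)
  have lim: "(\<lambda>k. coeff (lin_op a b (cpoly (root_poly (w (e k)) {..<n}))) j)
      \<longlonglongrightarrow> coeff (lin_op a b (cpoly (root_poly z {..<n}))) j"
    if "\<And>i. i < n \<Longrightarrow> ((\<lambda>\<epsilon>. w \<epsilon> i) \<longlongrightarrow> z i) (at 0)" for w z j
  proof (rule tendsto_coeff_lin_op)
    fix j
    show "(\<lambda>k. coeff (cpoly (root_poly (w (e k)) {..<n})) j) \<longlonglongrightarrow> coeff (cpoly (root_poly z {..<n})) j"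
      unfolding coeff_cpoly
      by (intro tendsto_of_real tendsto_coeff_root_poly filterlim_compose[OF that e])
  qed
  show ?thesis
  proof (rule hyperbolic_spectral_le_limit(3)[
        of "\<lambda>k. lin_op a b (cpoly (root_poly (v (e k)) {..<n}))" N
           "\<lambda>k. lin_op a b (cpoly (root_poly (u (e k)) {..<n}))"])
    show "spectral_le (lin_op a b (cpoly (root_poly (u (e k)) {..<n})))
        (lin_op a b (cpoly (root_poly (v (e k)) {..<n})))" for k
      unfolding e_def by (rule K) simp
  qed (use lim u v in \<open>auto intro!: lin_op_hyperbolic[OF ok hyperbolic_cpoly_root_poly]\<close>)
qed

text \<open>Moving the midpoint to m + \<epsilon> and replacing d' by d' + \<epsilon> produces the
  generic situation for small positive \<epsilon> outside a finite set. Thus zeros may coincide with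
  those of the pair, d' may be 0, and T R may vanish at \<open>m\<close>.\<close>

lemma lin_op_pinch_simple:
  assumes ok: "lin_op_degrees a b n N" and b: "b \<noteq> 0"
    and ij: "i < n" "j < n" "i \<noteq> j" and inj: "inj_on z ({..<n} - {i, j})"
    and z: "z i = m - d" "z j = m + d" and d: "0 \<le> d'" "d' < d"
  shows "spectral_le (lin_op a b (cpoly (root_poly (z(i := m - d', j := m + d')) {..<n})))
    (lin_op a b (cpoly (root_poly z {..<n})))"
proof -
  define t where "t = lin_op a b (root_poly z ({..<n} - {i, j}))"
  show ?thesis
  \<comment> \<open>The polynomial T R can vanish identically, for instance when n = 2 and a = 0;
    pinching then leaves T p unchanged.\<close>
  proof (cases "t = 0")
    case True
    have "lin_op a b (root_poly (z(i := m - d', j := m + d')) {..<n}) = lin_op a b (root_poly z {..<n})"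
      using ij z True by (subst root_poly_pinch[of _ _ _ z m d d']) (auto simp: lin_op_add_smult t_def)
    then have "lin_op a b (cpoly (root_poly (z(i := m - d', j := m + d')) {..<n}))
        = lin_op a b (cpoly (root_poly z {..<n}))"
      by (metis cpoly_lin_op)
    then show ?thesis by (simp add: spectral_le_refl)
  next
    case False
    \<comment> \<open>The values of \<epsilon> at which a shifted zero of the pair hits some
      \<open>z l\<close>, or m + \<epsilon> is a zero of \<open>t\<close>.\<close>
    define S where "S = (\<lambda>l. z l - (m - d)) ` {..<n} \<union> (\<lambda>l. z l - (m + d)) ` {..<n}
      \<union> (\<lambda>w. w - m) ` {w. poly t w = 0}"
    have "finite S" unfolding S_def using poly_roots_finite[OF False] by auto
    have small: "\<forall>\<^sub>F k in sequentially. inverse (real (Suc k)) < d - d'"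
      using d by (intro order_tendstoD(2)[OF LIMSEQ_inverse_real_of_nat]) auto
    show ?thesis
    proof (rule lin_op_spectral_le_perturb[OF ok])
      define v where "v \<epsilon> = z(i := m + \<epsilon> - d, j := m + \<epsilon> + d)" for \<epsilon>
      define u where "u \<epsilon> = (v \<epsilon>)(i := m + \<epsilon> - (d' + \<epsilon>), j := m + \<epsilon> + (d' + \<epsilon>))" for \<epsilon>
      show "\<forall>\<^sub>F k in sequentially. spectral_le
          (lin_op a b (cpoly (root_poly (u (inverse (real (Suc k)))) {..<n})))
          (lin_op a b (cpoly (root_poly (v (inverse (real (Suc k)))) {..<n})))"
        using eventually_inverse_Suc_notin[OF \<open>finite S\<close>] small
      proof eventually_elim
        case (elim k)
        define \<epsilon> where "\<epsilon> = inverse (real (Suc k))"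
        have \<epsilon>: "\<epsilon> \<notin> S" "0 < \<epsilon>" "d' + \<epsilon> < d" using elim by (auto simp: \<epsilon>_def)
        have notin: "m + \<epsilon> - d \<noteq> z l" "m + \<epsilon> + d \<noteq> z l" if "l < n" for l
          using \<epsilon>(1) that by (force simp: S_def image_iff)+
        have "poly t (m + \<epsilon>) \<noteq> 0" using \<epsilon>(1) by (force simp: S_def image_iff)
        moreover have "root_poly (v \<epsilon>) ({..<n} - {i, j}) = root_poly z ({..<n} - {i, j})"
          by (rule root_poly_cong) (auto simp: v_def)
        moreover have "inj_on (v \<epsilon>) {..<n}"
        proof (rule inj_onI)
          fix k l assume kl: "k \<in> {..<n}" "l \<in> {..<n}" "v \<epsilon> k = v \<epsilon> l"
          then show "k = l"
            using ij d notin[of k] notin[of l] inj_onD[OF inj, of k l]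
            by (auto simp: v_def split: if_splits)
        qed
        ultimately have "spectral_le
          (lin_op a b (cpoly (root_poly ((v \<epsilon>)(i := m + \<epsilon> - (d' + \<epsilon>), j := m + \<epsilon> + (d' + \<epsilon>))) {..<n})))
          (lin_op a b (cpoly (root_poly (v \<epsilon>) {..<n})))"
          using \<epsilon> d ij by (intro lin_op_pinch_generic[OF ok b, where d = d]) (auto simp: v_def t_def)
        then show ?case by (simp add: u_def \<epsilon>_def)
      qed
      show "((\<lambda>\<epsilon>. v \<epsilon> l) \<longlongrightarrow> z l) (at 0)" for l
        using ij by (cases "l = i"; cases "l = j") (auto simp: v_def z intro!: tendsto_eq_intros)
      show "((\<lambda>\<epsilon>. u \<epsilon> l) \<longlongrightarrow> (z(i := m - d', j := m + d')) l) (at 0)" for l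
        using ij by (cases "l = i"; cases "l = j") (auto simp: u_def v_def intro!: tendsto_eq_intros)
    qed
  qed
qed

text \<open>The zeros outside the pair are separated by the shifts \<epsilon> l, different for
  different indices, while the pair stays fixed.\<close>

lemma lin_op_pinch:
  assumes ok: "lin_op_degrees a b n N" and b: "b \<noteq> 0"
    and ij: "i < n" "j < n" "i \<noteq> j"
    and z: "z i = m - d" "z j = m + d" and d: "0 \<le> d'" "d' < d"
  shows "spectral_le (lin_op a b (cpoly (root_poly (z(i := m - d', j := m + d')) {..<n})))
    (lin_op a b (cpoly (root_poly z {..<n})))"
proof (rule lin_op_spectral_le_perturb[OF ok])
  define v where "v \<epsilon> l = (if l = i \<or> l = j then z l else z l + \<epsilon> * real l)" for \<epsilon> l
  define u where "u \<epsilon> = (v \<epsilon>)(i := m - d', j := m + d')" for \<epsilon>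
  \<comment> \<open>The values of \<epsilon> making two shifted zeros coincide. For k = l the
    quotient is 0 by convention, which no parameter 1/(k + 1) equals.\<close>
  define S where "S = (\<lambda>(k, l). (z k - z l) / (real l - real k)) ` ({..<n} \<times> {..<n})"
  have "finite S" by (simp add: S_def)
  show "\<forall>\<^sub>F k in sequentially. spectral_le
      (lin_op a b (cpoly (root_poly (u (inverse (real (Suc k)))) {..<n})))
      (lin_op a b (cpoly (root_poly (v (inverse (real (Suc k)))) {..<n})))"
    using eventually_inverse_Suc_notin[OF \<open>finite S\<close>]
  proof eventually_elim
    case (elim k)
    define \<epsilon> where "\<epsilon> = inverse (real (Suc k))"
    have \<epsilon>: "\<epsilon> \<notin> S" using elim by (simp add: \<epsilon>_def)
    have "inj_on (v \<epsilon>) ({..<n} - {i, j})"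
    proof (rule inj_onI, rule ccontr)
      fix k l assume kl: "k \<in> {..<n} - {i, j}" "l \<in> {..<n} - {i, j}" "v \<epsilon> k = v \<epsilon> l" "k \<noteq> l"
      then have "\<epsilon> * (real l - real k) = z k - z l" by (auto simp: v_def algebra_simps)
      then have "\<epsilon> = (z k - z l) / (real l - real k)" using kl by (simp add: field_simps)
      then show False using \<epsilon> kl by (force simp: S_def)
    qed
    then show ?case
      unfolding u_def \<epsilon>_def[symmetric]
      by (intro lin_op_pinch_simple[OF ok b ij]) (use z d in \<open>auto simp: v_def\<close>)
  qed
  show "((\<lambda>\<epsilon>. v \<epsilon> l) \<longlongrightarrow> z l) (at 0)" for l
    by (cases "l = i \<or> l = j") (auto simp: v_def intro!: tendsto_eq_intros)
  show "((\<lambda>\<epsilon>. u \<epsilon> l) \<longlongrightarrow> (z(i := m - d', j := m + d')) l) (at 0)" for l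
    by (cases "l = i \<or> l = j") (auto simp: u_def v_def intro!: tendsto_eq_intros)
qed

lemma isotonic_lin_op:
  assumes ok: "lin_op_degrees a b n N"
  shows "isotonic n N (lin_op a b)"
proof (cases "b = 0")
  case True
  then have "a = 1" "N = n" using ok by (auto simp: lin_op_degrees_def)
  with True show ?thesis by (auto simp: lin_op_def isotonic_def)
next
  case b: False
  have "spectral_le (lin_op a b Q) (lin_op a b P)"
    if hyp: "P \<in> hyperbolic n" "Q \<in> hyperbolic n" and le: "spectral_le Q P" for P Q
  proof -
    obtain y where y: "P = cpoly (root_poly y {..<n})" "\<And>i j. i \<le> j \<Longrightarrow> j < n \<Longrightarrow> y i \<le> y j"
      using hyperbolicE[OF hyp(1)] by metis
    obtain x where x: "Q = cpoly (root_poly x {..<n})" "\<And>i j. i \<le> j \<Longrightarrow> j < n \<Longrightarrow> x i \<le> x j"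
      using hyperbolicE[OF hyp(2)] by metis
    have sums: "(\<Sum>i<n. f (x i)) \<le> (\<Sum>i<n. f (y i))" if "convex_on UNIV f" for f :: "real \<Rightarrow> real"
      using le that unfolding x(1) y(1) spectral_le_root_poly[OF finite_lessThan] by blast
    note ps = partial_sums_of_convex_sums[of n y x, OF y(2) sums]
    show ?thesis unfolding y(1)
    proof (rule majorization_induct[of n x y, OF x(2) ps])
      fix w assume "\<And>i. i < n \<Longrightarrow> w i = x i"
      then have "root_poly w {..<n} = root_poly x {..<n}" by (intro root_poly_cong) auto
      then show "spectral_le (lin_op a b Q) (lin_op a b (cpoly (root_poly w {..<n})))"
        by (simp add: x spectral_le_refl)
    next
      fix w i j and \<delta> :: real
      assume ij: "i < j" "j < n" and \<delta>: "0 \<le> \<delta>" "w i + \<delta> \<le> w j - \<delta>"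
        and IH: "spectral_le (lin_op a b Q)
          (lin_op a b (cpoly (root_poly (w(i := w i + \<delta>, j := w j - \<delta>)) {..<n})))"
      show "spectral_le (lin_op a b Q) (lin_op a b (cpoly (root_poly w {..<n})))"
      proof (cases "\<delta> = 0")
        case True
        then show ?thesis using IH by simp
      next
        case False
        \<comment> \<open>Moving mass \<delta> inwards from both ends is a pinch from half-distance
          \<open>d\<close> to d - \<delta>. It is a strict one since \<delta> = 0 has been split
          off, and w i + \<delta> \<le> w j - \<delta> says that d' is nonnegative.\<close>
        define m d d' where "m = (w i + w j) / 2" and "d = (w j - w i) / 2" and "d' = d - \<delta>"
        have "spectral_le (lin_op a b (cpoly (root_poly (w(i := m - d', j := m + d')) {..<n})))
            (lin_op a b (cpoly (root_poly w {..<n})))"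
          by (rule lin_op_pinch[OF ok b, where d = d])
             (use ij \<delta> False in \<open>auto simp: m_def d_def d'_def field_simps\<close>)
        moreover have "m - d' = w i + \<delta>" "m + d' = w j - \<delta>"
          by (auto simp: m_def d_def d'_def field_simps)
        ultimately show ?thesis using IH spectral_le_trans by simp
      qed
    qed auto
  qed
  then show ?thesis using lin_op_hyperbolic[OF ok] by (auto simp: isotonic_def)
qed

subsection \<open>Operators given by power series\<close>

text \<open>The same formula as \<open>diff_op\<close>, with a formal power series as symbol:
  products and limits of symbols can then be handled coefficientwise, without convergence
  questions.\<close>

definition fps_op :: "complex fps \<Rightarrow> complex poly \<Rightarrow> complex poly" where
  "fps_op F P = (\<Sum>k\<le>degree P. smult (fps_nth F k) ((pderiv ^^ k) P))"

lemma higher_pderiv_eq_0: "degree P < k \<Longrightarrow> (pderiv ^^ k) P = 0"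
  for P :: "'a::{comm_semiring_1,semiring_no_zero_divisors} poly"
  by (rule poly_eqI) (simp add: coeff_higher_pderiv coeff_eq_0)

lemma fps_op_eq_sum:
  "degree P \<le> M \<Longrightarrow> fps_op F P = (\<Sum>k\<le>M. smult (fps_nth F k) ((pderiv ^^ k) P))"
  unfolding fps_op_def by (rule sum.mono_neutral_left) (auto simp: higher_pderiv_eq_0)

lemma degree_fps_op_le: "degree (fps_op F P) \<le> degree P"
  unfolding fps_op_def
  by (intro degree_sum_le order_trans[OF degree_smult_le]) (auto simp: degree_higher_pderiv)

lemma smult_sum_right: "smult c (\<Sum>i\<in>I. f i) = (\<Sum>i\<in>I. smult c (f i))"
  by (induction I rule: infinite_finite_induct) (simp_all add: smult_add_right)

text \<open>The Cauchy product sums over the triangle i + j \<le> M. It may be enlarged to the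
  square, because derivatives of order above the degree \<open>M\<close> vanish.\<close>

lemma fps_op_mult: "fps_op (F * G) P = fps_op F (fps_op G P)"
proof -
  define M where "M = degree P"
  let ?h = "\<lambda>i j. smult (fps_nth F i * fps_nth G j) ((pderiv ^^ (i + j)) P)"
  have "fps_op (F * G) P = (\<Sum>k\<le>M. \<Sum>i\<le>k. ?h i (k - i))"
    by (simp add: fps_op_def M_def fps_mult_nth smult_sum atLeast0AtMost)
  also have "\<dots> = (\<Sum>(i, j)\<in>{(i, j). i + j \<le> M}. ?h i j)"
    by (rule sum.triangle_reindex_eq[symmetric])
  also have "\<dots> = (\<Sum>(i, j)\<in>{..M} \<times> {..M}. ?h i j)"
    by (rule sum.mono_neutral_left) (auto simp: M_def, metis higher_pderiv_eq_0 not_le)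
  also have "\<dots> = (\<Sum>i\<le>M. \<Sum>j\<le>M. ?h i j)"
    by (rule sum.cartesian_product[symmetric])
  also have "\<dots> = (\<Sum>i\<le>M. smult (fps_nth F i) ((pderiv ^^ i) (fps_op G P)))"
    by (simp add: fps_op_def M_def higher_pderiv_sum higher_pderiv_smult smult_sum_right funpow_add)
  also have "\<dots> = fps_op F (fps_op G P)"
    by (rule fps_op_eq_sum[symmetric]) (simp add: M_def degree_fps_op_le)
  finally show ?thesis .
qed

lemma fps_op_const: "fps_op (fps_const c) P = smult c P"
  unfolding fps_op_def by (subst sum.remove[of _ 0]) auto

lemma fps_op_X_power: "fps_op (fps_X ^ m) P = (pderiv ^^ m) P"
proof -
  have "fps_op (fps_X ^ m) P = (\<Sum>k\<le>max m (degree P). smult (if k = m then 1 else 0) ((pderiv ^^ k) P))"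
    by (subst fps_op_eq_sum[of _ "max m (degree P)"]) auto
  also have "\<dots> = (pderiv ^^ m) P" by (subst sum.remove[of _ m]) auto
  finally show ?thesis .
qed

section \<open>Symbols of order-preserving operators\<close>

definition isotonic_fps :: "complex fps \<Rightarrow> bool" where
  "isotonic_fps F \<longleftrightarrow> (\<forall>n. isotonic n n (fps_op F))"

text \<open>Applied to the constant 1, the operator returns the constant coefficient, which must be
  a monic polynomial.\<close>

lemma isotonic_fps_nth_0:
  assumes "isotonic_fps F"
  shows "fps_nth F 0 = 1"
proof -
  have "1 \<in> hyperbolic 0" by (simp add: hyperbolic_def)
  then have "fps_op F 1 \<in> hyperbolic 0"
    using assms by (simp add: isotonic_fps_def isotonic_def)
  then show ?thesis by (simp add: fps_op_def hyperbolic_def)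
qed

lemma isotonic_fps_1: "isotonic_fps 1"
  using isotonic_cong[OF isotonic_id] fps_op_const[of 1] by (simp add: isotonic_fps_def)

lemma isotonic_fps_mult: "isotonic_fps F \<Longrightarrow> isotonic_fps G \<Longrightarrow> isotonic_fps (F * G)"
  by (auto simp: isotonic_fps_def fps_op_mult[abs_def] intro: isotonic_compose)

lemma isotonic_fps_power: "isotonic_fps F \<Longrightarrow> isotonic_fps (F ^ N)"
  by (induction N) (auto intro: isotonic_fps_1 isotonic_fps_mult)

lemma isotonic_fps_prod: "(\<And>i. i \<in> I \<Longrightarrow> isotonic_fps (F i)) \<Longrightarrow> isotonic_fps (prod F I)"
  by (induction I rule: infinite_finite_induct) (auto intro: isotonic_fps_1 isotonic_fps_mult)

lemma isotonic_fps_limit: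
  assumes "\<And>k. isotonic_fps (F k)" "\<And>j. (\<lambda>k. fps_nth (F k) j) \<longlonglongrightarrow> fps_nth G j"
  shows "isotonic_fps G"
  unfolding isotonic_fps_def
proof
  fix n
  show "isotonic n n (fps_op G)"
  proof (rule isotonic_limit)
    show "isotonic n n (fps_op (F k))" for k using assms(1) by (simp add: isotonic_fps_def)
    show "(\<lambda>k. coeff (fps_op (F k) P) j) \<longlonglongrightarrow> coeff (fps_op G P) j" for P j
      unfolding fps_op_def coeff_sum coeff_smult by (intro tendsto_intros assms)
  qed
qed

lemma isotonic_fps_linear: "isotonic_fps (1 + fps_const (of_real b) * fps_X)"
  unfolding isotonic_fps_def
proof
  fix n
  show "isotonic n n (fps_op (1 + fps_const (of_real b) * fps_X))"
  proof (rule isotonic_cong[OF isotonic_lin_op])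
    show "lin_op_degrees 1 b n n" by (simp add: lin_op_degrees_def)
    fix P :: "complex poly"
    have "fps_op (1 + fps_const (of_real b) * fps_X) P
        = (\<Sum>k\<in>{..Suc (degree P)}. smult (fps_nth (1 + fps_const (of_real b) * fps_X) k) ((pderiv ^^ k) P))"
      by (rule fps_op_eq_sum) simp
    also have "\<dots> = (\<Sum>k\<in>{0, 1}. smult (fps_nth (1 + fps_const (of_real b) * fps_X) k) ((pderiv ^^ k) P))"
      by (rule sum.mono_neutral_right) auto
    also have "\<dots> = lin_op 1 b P" by (simp add: lin_op_def)
    finally show "fps_op (1 + fps_const (of_real b) * fps_X) P = lin_op 1 b P" .
  qed
qed

section \<open>Exponentials as limits of powers\<close>

lemma tendsto_binomial_over_power:
  "(\<lambda>N. of_nat (Suc N choose i) * (1 / of_nat (Suc N)) ^ i) \<longlonglongrightarrow> (1 / fact i :: complex)"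
proof -
  have eq: "of_nat (Suc N choose i) * (1 / of_nat (Suc N)) ^ i
      = (\<Prod>l\<in>{0..<i}. 1 - of_nat l * inverse (of_nat (Suc N))) / (fact i :: complex)" for N
  proof -
    have nz: "of_nat (Suc N) \<noteq> (0 :: complex)" by (simp del: of_nat_Suc)
    have "of_nat (Suc N choose i) * (1 / of_nat (Suc N)) ^ i
        = (\<Prod>l\<in>{0..<i}. of_nat (Suc N) - of_nat l) * (\<Prod>l\<in>{0..<i}. inverse (of_nat (Suc N))) / (fact i :: complex)"
      by (simp add: binomial_gbinomial gbinomial_prod_rev field_simps del: of_nat_Suc)
    also have "\<dots> = (\<Prod>l\<in>{0..<i}. (of_nat (Suc N) - of_nat l) * inverse (of_nat (Suc N))) / (fact i :: complex)"
      by (simp only: prod.distrib)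
    also have "(\<lambda>l. (of_nat (Suc N) - of_nat l) * inverse (of_nat (Suc N)))
        = (\<lambda>l. 1 - of_nat l * inverse (of_nat (Suc N)) :: complex)"
      using nz by (simp add: field_simps del: of_nat_Suc)
    finally show ?thesis .
  qed
  have "(\<lambda>N. (\<Prod>l\<in>{0..<i}. 1 - of_nat l * inverse (of_nat (Suc N))) / (fact i :: complex))
      \<longlonglongrightarrow> (\<Prod>l\<in>{0..<i}. 1 - of_nat l * 0) / fact i"
    by (intro tendsto_intros LIMSEQ_Suc[OF lim_inverse_n]) auto
  then show ?thesis unfolding eq by simp
qed

text \<open>The limit (1 + A/N)^N -> exp A, read coefficientwise. As \<open>A\<close> has no
  constant term, A^i contributes to the coefficient of index \<open>j\<close> only for i \<le> j, so
  the binomial sum has a range independent of N.\<close>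

lemma tendsto_fps_exp_compose:
  assumes "fps_nth A 0 = 0"
  shows "(\<lambda>N. fps_nth ((1 + fps_const (1 / of_nat (Suc N)) * A) ^ Suc N) j)
    \<longlonglongrightarrow> fps_nth (fps_exp 1 oo A :: complex fps) j"
proof -
  have eq: "fps_nth ((1 + fps_const (1 / of_nat (Suc N)) * A) ^ Suc N) j
      = (\<Sum>i\<le>j. of_nat (Suc N choose i) * (1 / of_nat (Suc N)) ^ i * fps_nth (A ^ i) j)" for N
  proof -
    let ?g = "\<lambda>i. of_nat (Suc N choose i) * (1 / of_nat (Suc N)) ^ i * fps_nth (A ^ i) j"
    have nthj: "fps_nth (of_nat k * F) j = of_nat k * fps_nth F j" for k and F :: "complex fps"
      by (simp flip: fps_of_nat)
    define B where "B = fps_const (1 / of_nat (Suc N)) * A"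
    have "fps_nth ((1 + B) ^ Suc N) j = (\<Sum>i\<le>Suc N. ?g i)"
      unfolding add.commute[of _ B] binomial_ring power_one mult_1_right fps_sum_nth
      unfolding B_def
      by (intro sum.cong refl)
        (simp only: mult.assoc nthj power_mult_distrib fps_const_power fps_mult_left_const_nth)
    also have "\<dots> = (\<Sum>i\<le>max j (Suc N). ?g i)"
      by (rule sum.mono_neutral_left) (auto simp del: binomial_Suc_Suc of_nat_Suc)
    also have "\<dots> = (\<Sum>i\<le>j. ?g i)"
      using startsby_zero_power_prefix[OF assms] by (intro sum.mono_neutral_right) auto
    finally show ?thesis unfolding B_def .
  qed
  have "(\<lambda>N. \<Sum>i\<le>j. of_nat (Suc N choose i) * (1 / of_nat (Suc N)) ^ i * fps_nth (A ^ i) j)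
      \<longlonglongrightarrow> (\<Sum>i\<le>j. 1 / fact i * fps_nth (A ^ i) j)"
    by (intro tendsto_sum tendsto_mult tendsto_binomial_over_power tendsto_const)
  moreover have "(\<Sum>i\<le>j. 1 / fact i * fps_nth (A ^ i) j) = fps_nth (fps_exp 1 oo A) j"
    by (simp add: fps_compose_nth atLeast0AtMost)
  ultimately show ?thesis unfolding eq by simp
qed

lemma isotonic_fps_exp: "isotonic_fps (fps_exp (of_real b))"
proof -
  have "isotonic_fps (fps_exp 1 oo (fps_const (of_real b) * fps_X))"
  proof (rule isotonic_fps_limit)
    fix N
    have "fps_const (1 / of_nat (Suc N)) * (fps_const (of_real b) * fps_X)
        = fps_const (of_real (b / real (Suc N))) * (fps_X :: complex fps)"
      by (simp add: mult.assoc[symmetric] del: of_nat_Suc)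
    then show "isotonic_fps ((1 + fps_const (1 / of_nat (Suc N)) * (fps_const (of_real b) * fps_X)) ^ Suc N)"
      using isotonic_fps_power[OF isotonic_fps_linear] by metis
  qed (rule tendsto_fps_exp_compose, simp)
  moreover have "fps_exp 1 oo (fps_const (of_real b) * fps_X) = (fps_exp (of_real b) :: complex fps)"
    unfolding fps_compose_linear by (simp add: fps_eq_iff)
  ultimately show ?thesis by simp
qed

text \<open>The sign of the exponent is essential: 1 - s^2 X^2 with s = a / sqrt N splits into the
  real factors 1 + s X and 1 - s X.\<close>

lemma isotonic_fps_gauss: "isotonic_fps (fps_exp 1 oo (fps_const (- (of_real a)\<^sup>2) * fps_X\<^sup>2))"
proof (rule isotonic_fps_limit)
  fix N
  define s where "s = a / sqrt (real (Suc N))"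
  have s2: "s\<^sup>2 = a\<^sup>2 / real (Suc N)" by (simp add: s_def power_divide)
  have "fps_const (1 / of_nat (Suc N)) * (fps_const (- (of_real a)\<^sup>2) * fps_X\<^sup>2)
      = fps_const (of_real (- (s\<^sup>2))) * (fps_X\<^sup>2 :: complex fps)"
    unfolding s2 by (simp add: mult.assoc[symmetric] del: of_nat_Suc)
  also have "1 + \<dots> = (1 + fps_const (of_real s) * fps_X) * (1 + fps_const (of_real (- s)) * fps_X)"
    by (simp add: algebra_simps power2_eq_square flip: fps_const_mult fps_const_neg)
  finally show "isotonic_fps ((1 + fps_const (1 / of_nat (Suc N)) *
      (fps_const (- (of_real a)\<^sup>2) * fps_X\<^sup>2)) ^ Suc N)"
    using isotonic_fps_power[OF isotonic_fps_mult[OF isotonic_fps_linear isotonic_fps_linear]] by metis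
qed (rule tendsto_fps_exp_compose, simp)

text \<open>Each differentiation is divided by the current degree; these degrees multiply to n! / (n
  - m)!.\<close>

lemma isotonic_normalized_pderiv:
  "m \<le> n \<Longrightarrow> isotonic n (n - m) (\<lambda>P. smult (fact (n - m) / fact n) ((pderiv ^^ m) P))"
proof (induction m)
  case 0
  then show ?case using isotonic_id by simp
next
  case (Suc m)
  define k where "k = n - Suc m"
  have k: "n - m = Suc k" using Suc by (simp add: k_def)
  have "isotonic (n - m) k (lin_op 0 (1 / real (n - m)))"
    unfolding k by (rule isotonic_lin_op) (simp add: lin_op_degrees_def)
  moreover have "isotonic n (n - m) (\<lambda>P. smult (fact (n - m) / fact n) ((pderiv ^^ m) P))"
    using Suc by simp
  ultimately have "isotonic n k (\<lambda>P. lin_op 0 (1 / real (n - m)) (smult (fact (n - m) / fact n) ((pderiv ^^ m) P)))"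
    by (rule isotonic_compose[rotated])
  moreover have "lin_op 0 (1 / real (n - m)) (smult (fact (n - m) / fact n) ((pderiv ^^ m) P))
      = smult (fact k / fact n) ((pderiv ^^ Suc m) P)" for P :: "complex poly"
  proof -
    have "1 + complex_of_nat k \<noteq> 0" by (metis of_nat_Suc of_nat_neq_0)
    then show ?thesis unfolding k by (simp add: lin_op_def pderiv_smult)
  qed
  ultimately show ?case by (simp add: k_def)
qed

text \<open>Only Taylor coefficients at 0 matter, so uniform convergence on a small disc suffices:
  by Weierstrass the coefficients of the finite products, which are isotonic, converge to those of
  the infinite one.\<close>

lemma genus_1_product_expansion:
  fixes \<alpha> :: "nat \<Rightarrow> real"
  assumes sq: "summable (\<lambda>k. (\<alpha> k)\<^sup>2)"
  obtains G where "isotonic_fps G"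
    "(\<lambda>z. \<Prod>k. (1 - of_real (\<alpha> k) * z) * exp (of_real (\<alpha> k) * z)) has_fps_expansion G"
proof -
  define f where "f k z = (1 - of_real (\<alpha> k) * z) * exp (of_real (\<alpha> k) * z)" for k and z :: complex
  have fw: "f k z = weierstrass_factor 1 (of_real (\<alpha> k) * z)" for k z
    by (simp add: f_def weierstrass_factor_def)
  obtain K where K: "\<And>k. \<bar>(\<alpha> k)\<^sup>2\<bar> \<le> K"
    using summable_imp_Bseq[OF sq] by (auto simp: Bseq_def)
  \<comment> \<open>Chosen to give |\<alpha>_k z| \<le> 1/2 on the disc, as the bound for
    Weierstrass factors requires; K + 1 avoids division by 0 when all \<alpha>_k vanish.\<close>
  define r where "r = 1 / (2 * sqrt (K + 1))"
  have K0: "K \<ge> 0" using K[of 0] by linarith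
  then have sK: "sqrt (K + 1) \<ge> 1" by simp
  have "1 \<le> 2 * sqrt (K + 1)" using sK by linarith
  then have r: "0 < r" "r \<le> 1" using K0 by (simp_all add: r_def divide_le_eq_1)
  have small: "norm (of_real (\<alpha> k) * z) \<le> 1 / 2" if "z \<in> cball 0 r" for k and z :: complex
  proof -
    have "(\<alpha> k)\<^sup>2 \<le> K + 1" using K[of k] by simp
    then have "\<bar>\<alpha> k\<bar> \<le> sqrt (K + 1)" by (simp add: real_le_rsqrt)
    then have "\<bar>\<alpha> k\<bar> * norm z \<le> sqrt (K + 1) * r"
      using that sK by (intro mult_mono) auto
    also have "\<dots> = 1 / 2" using sK by (simp add: r_def)
    finally show ?thesis by (simp add: norm_mult)
  qed
  have bound: "norm (f k z - 1) \<le> 3 * (\<alpha> k)\<^sup>2" if "z \<in> cball 0 r" for k z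
  proof -
    have "norm (f k z - 1) \<le> 3 * norm (of_real (\<alpha> k) * z) ^ Suc 1"
      unfolding fw by (rule weierstrass_factor_bound) (rule small[OF that])
    also have "\<dots> = 3 * ((\<alpha> k)\<^sup>2 * (norm z)\<^sup>2)"
      by (simp add: norm_mult power2_eq_square)
    also have "\<dots> \<le> 3 * ((\<alpha> k)\<^sup>2 * 1)"
      using that r by (intro mult_left_mono) (auto simp: power_le_one)
    finally show ?thesis by simp
  qed
  have sum3: "summable (\<lambda>k. 3 * (\<alpha> k)\<^sup>2)" using sq by (rule summable_mult)
  have "uniformly_convergent_on (cball 0 r) (\<lambda>N z. \<Prod>k<N. f k z)"
  proof (rule uniformly_convergent_on_prod')
    show "uniformly_convergent_on (cball 0 r) (\<lambda>N z. \<Sum>k<N. norm (f k z - 1))"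
      by (rule Weierstrass_m_test'[OF _ sum3]) (use bound in auto)
    show "continuous_on (cball 0 r) (f k)" for k
      unfolding f_def by (intro continuous_intros)
  qed auto
  then have lim0: "uniform_limit (cball 0 r) (\<lambda>N z. \<Prod>k<N. f k z) (\<lambda>z. lim (\<lambda>N. \<Prod>k<N. f k z)) sequentially"
    by (simp add: uniformly_convergent_uniform_limit_iff)
  \<comment> \<open>On this disc no factor vanishes, so \<open>prodinf\<close> is the limit of the
    partial products.\<close>
  have lim_eq: "lim (\<lambda>N. \<Prod>k<N. f k z) = (\<Prod>k. f k z)" if z: "z \<in> cball 0 r" for z
  proof (rule prodinf_eq_lim'[symmetric])
    have "summable (\<lambda>k. norm (f k z - 1))"
      by (rule summable_comparison_test'[OF sum3, of 0]) (use bound[OF z] in auto)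
    then show "convergent_prod (\<lambda>k. f k z)"
      by (intro abs_convergent_prod_imp_convergent_prod) (simp add: abs_convergent_prod_conv_summable)
    show "f k z \<noteq> 0" for k
      using small[OF z, of k] unfolding fw weierstrass_factor_eq_0_iff by auto
  qed
  have lim: "uniform_limit (cball 0 r) (\<lambda>N z. \<Prod>k<N. f k z) (\<lambda>z. \<Prod>k. f k z) sequentially"
    by (rule iffD1[OF uniform_limit_cong' lim0]) (use lim_eq in auto)
  have holf: "(\<lambda>z. \<Prod>k<N. f k z) holomorphic_on A" for N A
    unfolding f_def by (intro holomorphic_intros)
  have "(\<lambda>z. \<Prod>k. f k z) holomorphic_on ball 0 r"
  proof (rule holomorphic_uniform_limit[OF _ lim])
    show "\<forall>\<^sub>F N in sequentially. continuous_on (cball 0 r) (\<lambda>z. \<Prod>k<N. f k z) \<and>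
        (\<lambda>z. \<Prod>k<N. f k z) holomorphic_on ball 0 r"
      by (intro always_eventually allI conjI holf holomorphic_on_imp_continuous_on[OF holf])
  qed auto
  then have exp: "(\<lambda>z. \<Prod>k. f k z) has_fps_expansion fps_expansion (\<lambda>z. \<Prod>k. f k z) 0"
    using r by (intro has_fps_expansion_fps_expansion[of "ball 0 r"]) auto
  define H where "H N = (\<Prod>k<N. (1 + fps_const (of_real (- \<alpha> k)) * fps_X) * fps_exp (of_real (\<alpha> k)) :: complex fps)"
    for N :: nat
  have H: "(\<lambda>z. \<Prod>k<N. f k z) has_fps_expansion H N" for N
    unfolding f_def H_def
  proof (rule has_fps_expansion_prod)
    fix k
    have "(\<lambda>z. (1 + of_real (- \<alpha> k) * z) * exp (of_real (\<alpha> k) * z)) has_fps_expansion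
      (1 + fps_const (of_real (- \<alpha> k)) * fps_X) * (fps_exp (of_real (\<alpha> k)) :: complex fps)"
      by (intro fps_expansion_intros)
    then show "(\<lambda>z. (1 - of_real (\<alpha> k) * z) * exp (of_real (\<alpha> k) * z)) has_fps_expansion
      (1 + fps_const (of_real (- \<alpha> k)) * fps_X) * (fps_exp (of_real (\<alpha> k)) :: complex fps)"
      by simp
  qed
  have "isotonic_fps (fps_expansion (\<lambda>z. \<Prod>k. f k z) 0)"
  proof (rule isotonic_fps_limit)
    show "isotonic_fps (H N)" for N
      unfolding H_def
      by (intro isotonic_fps_prod isotonic_fps_mult isotonic_fps_linear isotonic_fps_exp)
    fix j
    have "(\<lambda>N. (deriv ^^ j) (\<lambda>z. \<Prod>k<N. f k z) 0) \<longlonglongrightarrow> (deriv ^^ j) (\<lambda>z. \<Prod>k. f k z) 0"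
      by (rule higher_deriv_complex_uniform_limit[OF uniform_limit_on_subset[OF lim ball_subset_cball]])
         (use r holf in auto)
    then show "(\<lambda>N. fps_nth (H N) j) \<longlonglongrightarrow> fps_nth (fps_expansion (\<lambda>z. \<Prod>k. f k z) 0) j"
      unfolding fps_nth_fps_expansion[OF H] fps_nth_fps_expansion[OF exp]
      by (intro tendsto_divide tendsto_const) auto
  qed
  then show thesis using that exp unfolding f_def by blast
qed

lemma laguerre_polya_order_expansion:
  assumes "\<phi> \<in> laguerre_polya_order m"
  obtains c H where "c \<noteq> 0" "isotonic_fps H" "\<phi> has_fps_expansion fps_const c * fps_X ^ m * H"
proof -
  obtain a b c \<alpha> l where c: "c \<noteq> 0" and sq: "summable (\<lambda>k. (\<alpha> k)\<^sup>2)"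
    and \<phi>: "\<And>z. \<phi> z = of_real c * z ^ l * exp (- (of_real a)\<^sup>2 * z\<^sup>2 + of_real b * z) *
            (\<Prod>k. (1 - of_real (\<alpha> k) * z) * exp (of_real (\<alpha> k) * z))"
    using assms unfolding laguerre_polya_order_def laguerre_polya_def by blast
  obtain G where G: "isotonic_fps G"
    "(\<lambda>z. \<Prod>k. (1 - of_real (\<alpha> k) * z) * exp (of_real (\<alpha> k) * z)) has_fps_expansion G"
    by (rule genus_1_product_expansion[OF sq])
  define A where "A = (fps_exp 1 oo (fps_const (- (of_real a)\<^sup>2) * fps_X\<^sup>2) :: complex fps)"
  define H where "H = A * fps_exp (of_real b) * G"
  have H: "isotonic_fps H"
    unfolding H_def A_def by (intro isotonic_fps_mult isotonic_fps_gauss isotonic_fps_exp G)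
  have "(exp \<circ> (\<lambda>z. - (of_real a)\<^sup>2 * z\<^sup>2)) has_fps_expansion A"
    unfolding A_def by (intro fps_expansion_intros) auto
  then have "(\<lambda>z. exp (- (of_real a)\<^sup>2 * z\<^sup>2)) has_fps_expansion A" by (simp add: comp_def)
  then have "(\<lambda>z. of_real c * z ^ l * (exp (- (of_real a)\<^sup>2 * z\<^sup>2) * exp (of_real b * z) *
      (\<Prod>k. (1 - of_real (\<alpha> k) * z) * exp (of_real (\<alpha> k) * z)))) has_fps_expansion
      fps_const (of_real c) * fps_X ^ l * H"
    unfolding H_def by (intro fps_expansion_intros G)
  also have "(\<lambda>z. of_real c * z ^ l * (exp (- (of_real a)\<^sup>2 * z\<^sup>2) * exp (of_real b * z) *
      (\<Prod>k. (1 - of_real (\<alpha> k) * z) * exp (of_real (\<alpha> k) * z)))) = \<phi>"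
    unfolding fun_eq_iff \<phi> exp_add by (simp only: mult.assoc simp_thms)
  finally have expansion: "\<phi> has_fps_expansion fps_const (of_real c) * fps_X ^ l * H" .
  \<comment> \<open>As H(0) = 1, the exponent \<open>l\<close> of the given representation is the
    order of the zero at 0, hence equal to \<open>m\<close>.\<close>
  have "fps_nth H 0 \<noteq> 0" using isotonic_fps_nth_0[OF H] by simp
  then have "H \<noteq> 0" "subdegree H = 0" by auto
  moreover have "fps_const (complex_of_real c) \<noteq> 0" using c by simp
  ultimately have "subdegree (fps_const (of_real c) * fps_X ^ l * H) = l"
    and "fps_const (of_real c) * fps_X ^ l * H \<noteq> 0"
    by (simp_all add: fps_X_power_subdegree)
  then have "zorder \<phi> 0 = int l" using has_fps_expansion_zorder_0[OF expansion] by simp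
  then have "l = m" using assms by (simp add: laguerre_polya_order_def)
  then show thesis using that[of "of_real c" H] c H expansion by simp
qed

theorem corollary1:
  fixes m n :: nat and \<phi> :: "complex \<Rightarrow> complex" and P Q :: "complex poly"
  assumes "n \<ge> m + 1"
    and "\<phi> \<in> laguerre_polya_order m"
    and "P \<in> hyperbolic n" and "Q \<in> hyperbolic n"
    and "spectral_le Q P"
  shows "normalized_diff_op m \<phi> n Q \<in> hyperbolic (n - m) \<and>
         normalized_diff_op m \<phi> n P \<in> hyperbolic (n - m) \<and>
         spectral_le (normalized_diff_op m \<phi> n Q) (normalized_diff_op m \<phi> n P)"
proof -
  obtain c H where c: "c \<noteq> 0" and H: "isotonic_fps H"
    and exp: "\<phi> has_fps_expansion fps_const c * fps_X ^ m * H"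
    using laguerre_polya_order_expansion[OF assms(2)] by blast
  let ?F = "fps_const c * fps_X ^ m * H"
  have "(deriv ^^ m) \<phi> 0 / fact m = fps_nth ?F m"
    using fps_nth_fps_expansion[OF exp] by simp
  also have "\<dots> = c"
    using isotonic_fps_nth_0[OF H] by (simp add: mult.assoc fps_X_power_mult_nth)
  finally have deriv_m: "(deriv ^^ m) \<phi> 0 = c * fact m" by (simp add: field_simps)
  \<comment> \<open>With the value of the m-th derivative found above, the normalizing factor is c
    n! / (n - m)!. So \<open>c\<close> cancels, and what remains is H(D) followed by the normalized
    m-th derivative.\<close>
  have binom: "of_nat (n choose m) * fact m * fact (n - m) = (fact n :: complex)"
    using assms(1) by (simp add: binomial_fact)
  have "normalized_diff_op m \<phi> n R = smult (fact (n - m) / fact n) ((pderiv ^^ m) (fps_op H R))" for R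
  proof -
    have "diff_op \<phi> R = fps_op ?F R"
      unfolding diff_op_def fps_op_def fps_nth_fps_expansion[OF exp] ..
    also have "\<dots> = smult c ((pderiv ^^ m) (fps_op H R))"
      by (simp add: fps_op_mult fps_op_const fps_op_X_power)
    finally show ?thesis
      unfolding normalized_diff_op_def deriv_m using c
      by (simp add: field_simps flip: binom)
  qed
  then have "normalized_diff_op m \<phi> n = (\<lambda>R. smult (fact (n - m) / fact n) ((pderiv ^^ m) (fps_op H R)))"
    by blast
  moreover have "isotonic n (n - m) (\<lambda>R. smult (fact (n - m) / fact n) ((pderiv ^^ m) (fps_op H R)))"
    by (rule isotonic_compose[of n n "fps_op H", OF _ isotonic_normalized_pderiv])
       (use H assms(1) in \<open>simp_all add: isotonic_fps_def\<close>)
  ultimately show ?thesis using assms(3-5) by (simp add: isotonic_def)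
qed

end
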